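(* Let $\{\hat{\lambda}_n\}_{n=1}^{N}$ and $\{\hat{\mu}_n\}_{n=1}^{N}$ be nonincreasing sequences of real numbers such that $\{\hat{\lambda}_n\}_{n=1}^{N}\succeq\{\hat{\mu}_n\}_{n=1}^{N}$. Every self-adjoint $N\times N$ matrix $\hat{G}$ with spectrum $\{\hat{\lambda}_n\}_{n=1}^{N}$ and diagonal $\{\hat{\mu}_n\}_{n=1}^{N}$ can be constructed as $\hat{G}=F^*F+\alpha\mathrm{I}$, where $\alpha$ is any real number with $\alpha\leq\lambda_{\min}(\hat{G})=\hat{\lambda}_N$ and $F$ is an $N\times N$ complex matrix constructed by the frame construction process (Steps A and B described in the context) applied with $\lambda_n:=\hat{\lambda}_n-\alpha$ and $\mu_n:=\hat{\mu}_n-\alpha$ for $n=1,\dots,N$. Moreover, any $\hat{G}$ constructed in this fashion (that is, $\hat G=F^*F+\alpha\mathrm{I}$ for any such $\alpha$ and any $F$ produced by the process) has spectrum $\{\hat{\lambda}_n\}_{n=1}^{N}$ and diagonal $\{\hat{\mu}_n\}_{n=1}^{N}$.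
   Context: Majorization: for nonincreasing real sequences $\{\lambda_n\}_{n=1}^N$ and $\{\mu_n\}_{n=1}^N$, one writes $\{\lambda_n\}_{n=1}^N\succeq\{\mu_n\}_{n=1}^N$ if $\sum_{m=1}^n\lambda_m\geq\sum_{m=1}^n\mu_m$ for all $n=1,\dots,N-1$ and $\sum_{m=1}^N\lambda_m=\sum_{m=1}^N\mu_m$. Spectra are listed with multiplicity in nonincreasing order. "Diagonal $\{\hat\mu_n\}_{n=1}^N$" means that the $n$th diagonal entry is $\hat\mu_n$. $\lambda_{\min}(\hat G)$ is the least eigenvalue of $\hat G$. A sequence of vectors $F=\{f_n\}_{n=1}^N$ in $\mathbb{C}^N$ is identified with the $N\times N$ matrix $F$ whose columns are the $f_n$'s. Frame construction process (in the case where the vectors lie in $\mathbb{C}^N$) for nonnegative nonincreasing sequences $\{\lambda_n\}_{n=1}^N\succeq\{\mu_n\}_{n=1}^N$: Step A. Let $\lambda_{N;m}:=\lambda_m$ for $m=1,\dots,N$. For $n=N,N-1,\ldots,2$ (in this order), construct $\{\lambda_{n-1;m}\}_{m=1}^N$ in terms of $\{\lambda_{n;m}\}_{m=1}^{N}$ as follows: for each $k=N,N-1,\ldots,1$ (in this order), if $k>n-1$, take $\lambda_{n-1;k}:=0$; otherwise, pick any $\lambda_{n-1;k}\in[A_{n-1;k},B_{n-1;k}]$, where $$A_{n-1;k}:=\max \bigg\{ \lambda_{n;k+1},\ \sum_{m=k}^{N} \lambda_{n;m} - \sum_{m=k+1}^{N} \lambda_{n-1;m} - \mu_n \bigg\},$$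 $$B_{n-1;k}:=\min \bigg\{ \lambda_{n;k},\ \min_{l=1,\dots,k} \bigg\{\sum_{m=l}^{n-1} \mu_m - \sum_{m=l+1}^{k} \lambda_{n;m} - \sum_{m=k+1}^{N} \lambda_{n-1;m} \bigg\}\bigg\},$$ with the convention that $\lambda_{n;N+1}=0$ and that sums over empty sets of indices are zero. Step B. For each $n=1,\dots,N$, let $p_n(x):=\prod_{m=1}^{N}(x-\lambda_{n;m})$. Take any $f_1\in\mathbb{C}^N$ such that $\|f_1\|^2=\mu_1$. For each $n=1,\dots,N-1$ (successively), choose any $f_{n+1}\in\mathbb{C}^N$ such that $$\|P_{n;\lambda}f_{n+1}\|^2=-\lim_{x\rightarrow\lambda}(x-\lambda)\frac{p_{n+1}(x)}{p_n(x)}\qquad \text{for all } \lambda\in\{\lambda_{n;m}\}_{m=1}^N,$$ where $P_{n;\lambda}$ denotes the orthogonal projection of $\mathbb{C}^N$ onto $\ker(\lambda \mathrm{I}-F_nF_n^* )$, with $F_nF_n^*=\sum_{m=1}^n f_mf_m^*$ the frame operator of $F_n:=\{f_m\}_{m=1}^{n}$. *)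

theory Defs
  imports "Jordan_Normal_Form.Schur_Decomposition" "Jordan_Normal_Form.Matrix_Kernel" Complex_Main
begin

text \<open>
  Scalar sequences and sequences of vectors are functions on \<open>nat\<close> whose relevant indices are
  \<open>1, \<dots>, N\<close>; entries of the vectors and matrices of Jordan_Normal_Form are indexed from \<open>0\<close>.
\<close>

definition majorizes :: "nat \<Rightarrow> (nat \<Rightarrow> real) \<Rightarrow> (nat \<Rightarrow> real) \<Rightarrow> bool" where
  "majorizes N lam mu \<longleftrightarrow>
     (\<forall>n\<in>{1..N - 1}. (\<Sum>m=1..n. lam m) \<ge> (\<Sum>m=1..n. mu m)) \<and>
     (\<Sum>m=1..N. lam m) = (\<Sum>m=1..N. mu m)"

definition self_adjoint :: "complex mat \<Rightarrow> bool" where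
  "self_adjoint A \<longleftrightarrow> mat_adjoint A = A"

text \<open>The eigenvalues of \<open>A\<close>, counted with multiplicity, are \<open>lam 1, \<dots>, lam N\<close>.\<close>

definition has_spectrum :: "nat \<Rightarrow> complex mat \<Rightarrow> (nat \<Rightarrow> real) \<Rightarrow> bool" where
  "has_spectrum N A lam \<longleftrightarrow>
     proots (char_poly A) = image_mset (\<lambda>n. complex_of_real (lam n)) (mset_set {1..N})"

definition has_diagonal :: "nat \<Rightarrow> complex mat \<Rightarrow> (nat \<Rightarrow> real) \<Rightarrow> bool" where
  "has_diagonal N A mu \<longleftrightarrow> (\<forall>n\<in>{1..N}. A $$ (n - 1, n - 1) = complex_of_real (mu n))"

text \<open>Meant for self-adjoint matrices, all of whose eigenvalues are real.\<close>

definition least_eigenvalue :: "complex mat \<Rightarrow> real" where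
  "least_eigenvalue A = Min {x. eigenvalue A (complex_of_real x)}"

definition vec_norm_sq :: "complex vec \<Rightarrow> real" where
  "vec_norm_sq v = (\<Sum>i<dim_vec v. (cmod (v $ i))\<^sup>2)"

text \<open>
  The orthogonal projection of \<open>v\<close> onto a subspace \<open>W\<close>: the unique \<open>p\<close> in \<open>W\<close> such that
  \<open>v - p\<close> is orthogonal to \<open>W\<close>.
\<close>

definition orth_proj :: "complex vec set \<Rightarrow> complex vec \<Rightarrow> complex vec" where
  "orth_proj W v = (THE p. p \<in> W \<and> (\<forall>w\<in>W. (v - p) \<bullet>c w = 0))"

definition synthesis :: "nat \<Rightarrow> (nat \<Rightarrow> complex vec) \<Rightarrow> nat \<Rightarrow> complex mat" where
  "synthesis N f n = mat_of_cols N (map f [1..<Suc n])"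

definition frame_operator :: "nat \<Rightarrow> (nat \<Rightarrow> complex vec) \<Rightarrow> nat \<Rightarrow> complex mat" where
  "frame_operator N f n = synthesis N f n * mat_adjoint (synthesis N f n)"

text \<open>
  Step A.  The double sequence is \<open>L\<close>, with \<open>L n m\<close> standing for \<open>\<lambda>\<^bsub>n;m\<^esub>\<close>;
  \<open>lower_end N mu L n k\<close> and \<open>upper_end N mu L n k\<close> are \<open>A\<^bsub>n-1;k\<^esub>\<close> and \<open>B\<^bsub>n-1;k\<^esub>\<close>.
\<close>

definition lower_end :: "nat \<Rightarrow> (nat \<Rightarrow> real) \<Rightarrow> (nat \<Rightarrow> nat \<Rightarrow> real) \<Rightarrow> nat \<Rightarrow> nat \<Rightarrow> real" where
  "lower_end N mu L n k =
     max (if k + 1 = N + 1 then 0 else L n (k + 1))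
         ((\<Sum>m=k..N. L n m) - (\<Sum>m=k+1..N. L (n - 1) m) - mu n)"

definition upper_end :: "nat \<Rightarrow> (nat \<Rightarrow> real) \<Rightarrow> (nat \<Rightarrow> nat \<Rightarrow> real) \<Rightarrow> nat \<Rightarrow> nat \<Rightarrow> real" where
  "upper_end N mu L n k =
     min (L n k)
         (Min ((\<lambda>l. (\<Sum>m=l..n-1. mu m) - (\<Sum>m=l+1..k. L n m) - (\<Sum>m=k+1..N. L (n - 1) m))
               ` {1..k}))"

text \<open>
  The possible outcomes of Step A: each choice is constrained only by choices made earlier
  in the prescribed order, so a completed run is a solution of all the constraints together.
\<close>

definition step_A :: "nat \<Rightarrow> (nat \<Rightarrow> real) \<Rightarrow> (nat \<Rightarrow> real) \<Rightarrow> (nat \<Rightarrow> nat \<Rightarrow> real) \<Rightarrow> bool" where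
  "step_A N lam mu L \<longleftrightarrow>
     (\<forall>m\<in>{1..N}. L N m = lam m) \<and>
     (\<forall>n\<in>{2..N}. \<forall>k\<in>{1..N}.
        if k > n - 1 then L (n - 1) k = 0
        else L (n - 1) k \<in> {lower_end N mu L n k .. upper_end N mu L n k})"

definition spec_poly :: "nat \<Rightarrow> (nat \<Rightarrow> nat \<Rightarrow> real) \<Rightarrow> nat \<Rightarrow> real \<Rightarrow> real" where
  "spec_poly N L n x = (\<Prod>m=1..N. x - L n m)"

text \<open>The existence of the limit is part of the condition imposed on \<open>f (n + 1)\<close>.\<close>

definition step_B ::
  "nat \<Rightarrow> (nat \<Rightarrow> real) \<Rightarrow> (nat \<Rightarrow> nat \<Rightarrow> real) \<Rightarrow> (nat \<Rightarrow> complex vec) \<Rightarrow> bool" where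
  "step_B N mu L f \<longleftrightarrow>
     (\<forall>n\<in>{1..N}. f n \<in> carrier_vec N) \<and>
     vec_norm_sq (f 1) = mu 1 \<and>
     (\<forall>n\<in>{1..N - 1}. \<forall>t\<in>L n ` {1..N}.
        ((\<lambda>x. (x - t) * (spec_poly N L (n + 1) x / spec_poly N L n x)) \<longlongrightarrow>
          - vec_norm_sq (orth_proj
               (mat_kernel (complex_of_real t \<cdot>\<^sub>m 1\<^sub>m N - frame_operator N f n)) (f (n + 1))))
        (at t))"

definition frame_construction ::
  "nat \<Rightarrow> (nat \<Rightarrow> real) \<Rightarrow> (nat \<Rightarrow> real) \<Rightarrow> complex mat \<Rightarrow> bool" where
  "frame_construction N lam mu F \<longleftrightarrow>
     (\<exists>L f. step_A N lam mu L \<and> step_B N mu L f \<and> F = synthesis N f N)"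

end

theory Submission
  imports Defs
begin

text \<open>
  Put \<open>A\<^sub>n = f\<^sub>1 f\<^sub>1\<^sup>* + \<dots> + f\<^sub>n f\<^sub>n\<^sup>*\<close>, so that each frame operator is a rank-one update of the one
  before it.  Let \<open>A\<close> be self-adjoint with eigenvalues \<open>a\<close> and let \<open>B = A + f f\<^sup>*\<close> have eigenvalues
  \<open>b\<close>.  In an orthonormal eigenbasis of \<open>A\<close>, in which \<open>f\<close> has coordinates \<open>g\<close>, the matrix
  determinant lemma gives

    \<open>\<Prod>\<^sub>m (x - b\<^sub>m) / \<Prod>\<^sub>m (x - a\<^sub>m) = 1 - \<Sum>\<^sub>i \<bar>g\<^sub>i\<bar>\<^sup>2 / (x - a\<^sub>i)\<close>

  (\<open>rank_one_update_ratio\<close>).  Multiplied by \<open>x - t\<close>, the right-hand side tends to minus the sum of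
  \<open>\<bar>g\<^sub>i\<bar>\<^sup>2\<close> over the \<open>i\<close> with \<open>a\<^sub>i = t\<close>, which is the squared norm of the projection of \<open>f\<close> onto the
  \<open>t\<close>-eigenspace: the condition of Step B holds for the true spectra of consecutive frame operators
  (\<open>rank_one_update_residue\<close>).  Conversely these limits determine \<open>b\<close>.  Two monic polynomials of
  degree \<open>N\<close> with the same limits differ by a polynomial of smaller degree that vanishes at every
  \<open>a\<^sub>m\<close> with at least its multiplicity, and that difference is therefore \<open>0\<close>
  (\<open>spectrum_determined_by_residues\<close>).

  Every outcome of the process is therefore correct.  The interval that Step A gives for the largest
  eigenvalue forces \<open>\<lambda>\<^bsub>n;1\<^esub> + \<dots> + \<lambda>\<^bsub>n;N\<^esub> = \<mu>\<^sub>1 + \<dots> + \<mu>\<^sub>n\<close>, Step B makes \<open>\<lambda>\<^bsub>n;1\<^esub>, \<dots>, \<lambda>\<^bsub>n;N\<^esub>\<close>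
  the spectrum of \<open>A\<^sub>n\<close>, and comparing traces gives \<open>\<parallel>f\<^sub>n\<parallel>\<^sup>2 = \<mu>\<^sub>n\<close>.  The matrices \<open>F\<^sup>* F\<close> and
  \<open>F F\<^sup>*\<close> share a characteristic polynomial, so \<open>F\<^sup>* F\<close> has the required spectrum and diagonal.

  In the other direction \<open>G - \<alpha> I\<close> is positive semidefinite, thus of the form \<open>F\<^sup>* F\<close>.  Take the
  columns of \<open>F\<close> as vectors and the sorted spectra of the \<open>A\<^sub>n\<close> as \<open>\<lambda>\<^bsub>n;m\<^esub>\<close>.  Step B is the residue
  formula, and Step A follows from traces together with interlacing,
  \<open>\<lambda>\<^bsub>n+1;m+1\<^esub> \<le> \<lambda>\<^bsub>n;m\<^esub> \<le> \<lambda>\<^bsub>n+1;m\<^esub>\<close> (\<open>rank_one_update_interlacing\<close>).  The inequality that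
  is not local in \<open>n\<close>, \<open>\<Sum>\<^bsub>m\<ge>l\<^esub> \<lambda>\<^bsub>n;m\<^esub> \<le> \<mu>\<^sub>l + \<dots> + \<mu>\<^sub>n\<close>, is Schur's; it holds because
  \<open>\<mu>\<^sub>1 + \<dots> + \<mu>\<^bsub>l-1\<^esub>\<close> is the trace of \<open>A\<^bsub>l-1\<^esub>\<close>, whose at most \<open>l - 1\<close> nonzero eigenvalues can only
  grow on the way to \<open>A\<^sub>n\<close> (\<open>tail_sum_le\<close>).
\<close>

section \<open>Adjoints and unitary matrices\<close>

lemma mat_adjoint_index [simp]:
  "i < dim_col A \<Longrightarrow> j < dim_row A \<Longrightarrow> mat_adjoint A $$ (i, j) = cnj (A $$ (j, i))"
  for A :: "complex mat"
  by (simp add: mat_adjoint_def mat_of_rows_def)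

lemma mat_adjoint_dim [simp]:
  "dim_row (mat_adjoint A) = dim_col A" "dim_col (mat_adjoint A) = dim_row A"
  for A :: "complex mat"
  by (simp_all add: mat_adjoint_def)

lemma mat_adjoint_carrier [simp]:
  "A \<in> carrier_mat m n \<Longrightarrow> mat_adjoint A \<in> carrier_mat n m" for A :: "complex mat"
  by auto

lemma mat_adjoint_mat_adjoint [simp]: "mat_adjoint (mat_adjoint A) = A" for A :: "complex mat"
  by (rule eq_matI) auto

lemma mat_adjoint_one [simp]: "mat_adjoint (1\<^sub>m n) = (1\<^sub>m n :: complex mat)"
  by (rule eq_matI) auto

lemma mat_adjoint_mult:
  fixes A B :: "complex mat"
  assumes "A \<in> carrier_mat l m" "B \<in> carrier_mat m n"
  shows "mat_adjoint (A * B) = mat_adjoint B * mat_adjoint A"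
  using assms by (intro eq_matI) (auto simp: scalar_prod_def intro!: sum.cong)

lemma mat_adjoint_mat_diag_real [simp]:
  "mat_adjoint (mat_diag n (\<lambda>i. complex_of_real (d i))) = mat_diag n (\<lambda>i. complex_of_real (d i))"
  by (rule eq_matI) (auto simp: mat_diag_def)

lemma adjoint_mult_vec_inner:
  fixes A :: "complex mat"
  assumes "A \<in> carrier_mat m n" "v \<in> carrier_vec n" "w \<in> carrier_vec m"
  shows "(A *\<^sub>v v) \<bullet>c w = v \<bullet>c (mat_adjoint A *\<^sub>v w)"
proof -
  have "(A *\<^sub>v v) \<bullet>c w = (\<Sum>i<m. \<Sum>j<n. A $$ (i,j) * v $ j * cnj (w $ i))"
    using assms by (auto simp: scalar_prod_def sum_distrib_right lessThan_atLeast0 intro!: sum.cong)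
  also have "\<dots> = (\<Sum>j<n. \<Sum>i<m. A $$ (i,j) * v $ j * cnj (w $ i))"
    by (rule sum.swap)
  also have "\<dots> = v \<bullet>c (mat_adjoint A *\<^sub>v w)"
    using assms by (auto simp: scalar_prod_def sum_distrib_left lessThan_atLeast0 mult_ac intro!: sum.cong)
  finally show ?thesis .
qed

lemma inner_self: "v \<bullet>c v = complex_of_real (vec_norm_sq v)" for v :: "complex vec"
  unfolding scalar_prod_def vec_norm_sq_def of_real_sum complex_norm_square
  by (simp add: lessThan_atLeast0)

lemma vec_norm_sq_nonneg: "0 \<le> vec_norm_sq v"
  unfolding vec_norm_sq_def by (simp add: sum_nonneg)

lemma vec_norm_sq_pos:
  assumes "v \<in> carrier_vec n" "v \<noteq> 0\<^sub>v n" shows "0 < vec_norm_sq v"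
proof -
  obtain i where i: "i < n" "v $ i \<noteq> 0" using assms by (metis carrier_vecD eq_vecI index_zero_vec(1,2))
  have "(cmod (v $ i))\<^sup>2 \<le> vec_norm_sq v"
    unfolding vec_norm_sq_def using i assms by (intro member_le_sum) auto
  moreover have "0 < (cmod (v $ i))\<^sup>2" using i by simp
  ultimately show ?thesis by linarith
qed

lemma mult_assoc_nested:
  fixes A :: "'a :: semiring_0 mat"
  assumes "A \<in> carrier_mat n n" "B \<in> carrier_mat n n" "C \<in> carrier_mat n n"
    "D \<in> carrier_mat n n" "E \<in> carrier_mat n n"
  shows "A * (B * C * D) * E = (A * B) * C * (D * E)"
proof -
  note AB = mult_carrier_mat[OF assms(1,2)] and BC = mult_carrier_mat[OF assms(2,3)]
  have "A * (B * C * D) = A * B * C * D"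
    using assoc_mult_mat[OF assms(1) BC assms(4)] assoc_mult_mat[OF assms(1-3)] by simp
  then show ?thesis using assoc_mult_mat[OF mult_carrier_mat[OF AB assms(3)] assms(4,5)] by simp
qed

definition unitary :: "nat \<Rightarrow> complex mat \<Rightarrow> bool" where
  "unitary N U \<longleftrightarrow> U \<in> carrier_mat N N \<and> mat_adjoint U * U = 1\<^sub>m N"

lemma unitaryD:
  assumes "unitary N U"
  shows "U \<in> carrier_mat N N" "mat_adjoint U \<in> carrier_mat N N"
    "mat_adjoint U * U = 1\<^sub>m N" "U * mat_adjoint U = 1\<^sub>m N"
  using assms mat_mult_left_right_inverse[of "mat_adjoint U" N U] unfolding unitary_def by auto

lemma unitary_adjoint: "unitary N U \<Longrightarrow> unitary N (mat_adjoint U)"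
  using unitaryD[of N U] unfolding unitary_def by simp

lemma unitary_one: "unitary N (1\<^sub>m N)" unfolding unitary_def by simp

lemma unitary_mult:
  assumes "unitary N U" "unitary N V" shows "unitary N (U * V)"
proof -
  note U = unitaryD[OF assms(1)] and V = unitaryD[OF assms(2)]
  have "mat_adjoint (U * V) * (U * V) = mat_adjoint V * (mat_adjoint U * (U * V))"
    using U V by (simp add: mat_adjoint_mult[OF U(1) V(1)] assoc_mult_mat[of _ N N _ N _ N])
  also have "mat_adjoint U * (U * V) = V"
    using U V assoc_mult_mat[OF U(2) U(1) V(1)] by simp
  also have "mat_adjoint V * V = 1\<^sub>m N" by (rule V(3))
  finally show ?thesis using U V unfolding unitary_def by auto
qed

lemma unitary_cancel:
  assumes "unitary N U"
  shows "X \<in> carrier_mat N m \<Longrightarrow> mat_adjoint U * (U * X) = X"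
    "X \<in> carrier_mat N m \<Longrightarrow> U * (mat_adjoint U * X) = X"
    "v \<in> carrier_vec N \<Longrightarrow> mat_adjoint U *\<^sub>v (U *\<^sub>v v) = v"
    "v \<in> carrier_vec N \<Longrightarrow> U *\<^sub>v (mat_adjoint U *\<^sub>v v) = v"
proof -
  note U = unitaryD[OF assms]
  show "X \<in> carrier_mat N m \<Longrightarrow> mat_adjoint U * (U * X) = X"
    using U assoc_mult_mat[OF U(2) U(1), of X m] by simp
  show "X \<in> carrier_mat N m \<Longrightarrow> U * (mat_adjoint U * X) = X"
    using U assoc_mult_mat[OF U(1) U(2), of X m] by simp
  show "v \<in> carrier_vec N \<Longrightarrow> mat_adjoint U *\<^sub>v (U *\<^sub>v v) = v"
    using U assoc_mult_mat_vec[OF U(2) U(1), of v] by simp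
  show "v \<in> carrier_vec N \<Longrightarrow> U *\<^sub>v (mat_adjoint U *\<^sub>v v) = v"
    using U assoc_mult_mat_vec[OF U(1) U(2), of v] by simp
qed

lemma unitary_inner:
  assumes U: "unitary N U" and v: "v \<in> carrier_vec N" and w: "w \<in> carrier_vec N"
  shows "(U *\<^sub>v v) \<bullet>c (U *\<^sub>v w) = v \<bullet>c w"
proof -
  have "U *\<^sub>v w \<in> carrier_vec N" using unitaryD(1)[OF U] w by simp
  from adjoint_mult_vec_inner[OF unitaryD(1)[OF U] v this] show ?thesis
    by (simp only: unitary_cancel(3)[OF U w])
qed

lemma unitary_norm:
  assumes "unitary N U" "v \<in> carrier_vec N"
  shows "vec_norm_sq (U *\<^sub>v v) = vec_norm_sq v"
  using unitary_inner[OF assms assms(2)] by (simp only: inner_self of_real_eq_iff)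

lemma unitary_adjoint_nth:
  assumes U: "unitary N U" and "i < N" "j < N"
  shows "(\<Sum>k<N. cnj (U $$ (k, i)) * U $$ (k, j)) = (if i = j then 1 else 0)"
proof -
  have "(mat_adjoint U * U) $$ (i, j) = (if i = j then 1 else 0)" using assms unitaryD[OF U] by simp
  moreover have "(mat_adjoint U * U) $$ (i, j) = (\<Sum>k<N. cnj (U $$ (k, i)) * U $$ (k, j))"
    using assms(2,3) unitaryD(1)[OF U] by (auto simp: scalar_prod_def lessThan_atLeast0)
  ultimately show ?thesis by simp
qed

text \<open>
  The first column can be prescribed up to a scalar: complete \<open>v\<close> to a basis, orthogonalise, and
  normalise.  Deflation in the spectral theorem uses this for an eigenvector.
\<close>
lemma unitary_completion:
  fixes v :: "complex vec"
  assumes v: "v \<in> carrier_vec n" and v0: "v \<noteq> 0\<^sub>v n" and n: "n \<noteq> 0"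
  shows "\<exists>W c. unitary n W \<and> c \<noteq> 0 \<and> col W 0 = c \<cdot>\<^sub>v v"
proof -
  interpret cof_vec_space n "TYPE(complex)" .
  define b where "b = basis_completion v"
  define ws where "ws = gram_schmidt n b"
  from basis_completion[OF v v0, folded b_def]
  have dist_b: "distinct b" and indep: "\<not> lin_dep (set b)" and b: "set b \<subseteq> carrier_vec n"
    and hdb: "hd b = v" and len_b: "length b = n" by auto
  from hdb len_b n obtain vs where bv: "b = v # vs" by (cases b) auto
  from gram_schmidt_result[OF b dist_b indep refl, folded ws_def]
  have ws: "set ws \<subseteq> carrier_vec n" "corthogonal ws" "length ws = n" by (auto simp: len_b)
  from gram_schmidt_hd[OF v, of vs, folded bv] have "hd ws = v" unfolding ws_def .
  with ws n have ws0: "ws ! 0 = v" by (metis hd_conv_nth length_0_conv)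
  have wsc: "ws ! i \<in> carrier_vec n" if "i < n" for i using ws that by (auto simp: set_conv_nth)
  define r where "r i = complex_of_real (1 / sqrt (vec_norm_sq (ws ! i)))" for i
  define W where "W = mat_of_cols n (map (\<lambda>i. r i \<cdot>\<^sub>v (ws ! i)) [0..<n])"
  have W: "W \<in> carrier_mat n n" unfolding W_def
    using mat_of_cols_carrier(1)[of n "map (\<lambda>i. r i \<cdot>\<^sub>v (ws ! i)) [0..<n]"] by simp
  have colW: "col W i = r i \<cdot>\<^sub>v (ws ! i)" if "i < n" for i
    unfolding W_def using that wsc[OF that] by (subst col_mat_of_cols) auto
  have pos: "vec_norm_sq (ws ! i) > 0" if "i < n" for i
  proof -
    have "ws ! i \<bullet>c ws ! i \<noteq> 0" using corthogonalD[OF ws(2), of i i] that ws by auto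
    then show ?thesis using vec_norm_sq_nonneg[of "ws ! i"] by (auto simp: inner_self less_le)
  qed
  have "mat_adjoint W * W = 1\<^sub>m n"
  proof (rule eq_matI)
    fix i j assume "i < dim_row (1\<^sub>m n :: complex mat)" "j < dim_col (1\<^sub>m n :: complex mat)"
    then have ij: "i < n" "j < n" by auto
    have "(mat_adjoint W * W) $$ (i, j) = col W j \<bullet>c col W i"
      using ij W by (auto simp: scalar_prod_def mult_ac intro!: sum.cong)
    also have "\<dots> = r j * r i * (ws ! j \<bullet>c ws ! i)"
    proof -
      have "conjugate (r i \<cdot>\<^sub>v (ws ! i)) = r i \<cdot>\<^sub>v conjugate (ws ! i)"
        by (simp add: conjugate_smult_vec r_def)
      then show ?thesis
        using wsc[OF ij(1)] wsc[OF ij(2)] ij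
          smult_scalar_prod_distrib[of "ws ! j" n "r i \<cdot>\<^sub>v conjugate (ws ! i)" "r j"]
          scalar_prod_smult_distrib[of "ws ! j" n "conjugate (ws ! i)" "r i"]
        by (simp only: colW smult_carrier_vec carrier_vec_conjugate) simp
    qed
    also have "\<dots> = (if i = j then 1 else 0)"
    proof (cases "i = j")
      case True
      have "sqrt (vec_norm_sq (ws ! i)) * sqrt (vec_norm_sq (ws ! i)) = vec_norm_sq (ws ! i)"
        using pos[OF ij(1)] by simp
      then show ?thesis using pos[OF ij(1)] unfolding True r_def inner_self
        by (simp add: True flip: of_real_mult)
    next
      case False
      then show ?thesis using corthogonalD[OF ws(2), of j i] ij ws by simp
    qed
    finally show "(mat_adjoint W * W) $$ (i, j) = 1\<^sub>m n $$ (i, j)" using ij by simp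
  qed (use W in auto)
  then have "unitary n W" using W unfolding unitary_def by simp
  moreover have "r 0 \<noteq> 0" using pos[of 0] n unfolding r_def by simp
  ultimately show ?thesis using colW[of 0] n ws0 by auto
qed

section \<open>The spectral theorem\<close>

lemma similar_unitary:
  assumes U: "unitary n U" and D: "D \<in> carrier_mat n n"
  shows "similar_mat (U * D * mat_adjoint U) D"
  unfolding similar_mat_def
  using similar_mat_witI[OF unitaryD(4)[OF U] unitaryD(3)[OF U] refl _ D unitaryD(1)[OF U] unitaryD(2)[OF U]]
    mult_carrier_mat[OF mult_carrier_mat[OF unitaryD(1)[OF U] D] unitaryD(2)[OF U]] by blast

lemma unitary_conj_inverse:
  assumes U: "unitary n U" and D: "D \<in> carrier_mat n n"
  shows "mat_adjoint U * (U * D * mat_adjoint U) * U = D"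
proof -
  note Uc = unitaryD[OF U]
  have "mat_adjoint U * (U * D * mat_adjoint U) = D * mat_adjoint U"
    unfolding assoc_mult_mat[OF Uc(1) D Uc(2)]
    by (rule unitary_cancel(1)[OF U mult_carrier_mat[OF D Uc(2)]])
  then show ?thesis using assoc_mult_mat[OF D Uc(2) Uc(1)] right_mult_one_mat[OF D] Uc by simp
qed

lemma unitary_conj_scalar:
  assumes U: "unitary n U"
  shows "U * (c \<cdot>\<^sub>m 1\<^sub>m n) * mat_adjoint U = c \<cdot>\<^sub>m 1\<^sub>m n"
proof -
  note Uc = unitaryD[OF U]
  have "U * (c \<cdot>\<^sub>m 1\<^sub>m n) = c \<cdot>\<^sub>m U"
    using mult_smult_distrib[OF Uc(1) one_carrier_mat] Uc(1) by simp
  then show ?thesis using mult_smult_assoc_mat[OF Uc(1,2)] Uc(4) by simp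
qed

lemma self_adjoint_nth:
  assumes "self_adjoint A" "A \<in> carrier_mat n n" "i < n" "j < n"
  shows "A $$ (i, j) = cnj (A $$ (j, i))"
proof -
  have "A $$ (i, j) = mat_adjoint A $$ (i, j)" using assms(1) by (simp only: self_adjoint_def)
  also have "\<dots> = cnj (A $$ (j, i))" using assms(2-4) by (intro mat_adjoint_index) auto
  finally show ?thesis .
qed

lemma self_adjoint_conj:
  assumes A: "A \<in> carrier_mat n n" "self_adjoint A" and W: "W \<in> carrier_mat n n"
  shows "self_adjoint (mat_adjoint W * A * W)"
proof -
  have "mat_adjoint (mat_adjoint W * A * W) = mat_adjoint W * mat_adjoint (mat_adjoint W * A)"
    using A W by (intro mat_adjoint_mult[of _ n n]) auto
  also have "mat_adjoint (mat_adjoint W * A) = A * W"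
    using A W mat_adjoint_mult[of "mat_adjoint W" n n A n] by (simp add: self_adjoint_def)
  finally show ?thesis using A W unfolding self_adjoint_def
    by (simp add: assoc_mult_mat[of _ n n _ n _ n])
qed

lemma block_diag_mult:
  fixes A B :: "'a :: comm_ring_1 mat"
  assumes E: "E \<in> carrier_mat m m" "E' \<in> carrier_mat m m"
    and A: "A \<in> carrier_mat k k" "B \<in> carrier_mat k k"
  shows "four_block_mat E (0\<^sub>m m k) (0\<^sub>m k m) A * four_block_mat E' (0\<^sub>m m k) (0\<^sub>m k m) B =
    four_block_mat (E * E') (0\<^sub>m m k) (0\<^sub>m k m) (A * B)"
  using mult_four_block_mat[OF E(1) zero_carrier_mat zero_carrier_mat A(1)
      E(2) zero_carrier_mat zero_carrier_mat A(2)] E A by simp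

text \<open>
  The eigenvalues come out in the order in which the linear factors of the characteristic polynomial
  are listed, so any enumeration of the spectrum, in particular a sorted one, is realised by an
  eigenbasis.  The proof is deflation: in an orthonormal basis that starts with an eigenvector for
  the first root, the first column of the matrix is a multiple of the first unit vector, hence by
  self-adjointness so is the first row, and the remaining block carries the other roots.
\<close>
theorem spectral_theorem_list:
  assumes "A \<in> carrier_mat n n" "self_adjoint A" "char_poly A = (\<Prod>e\<leftarrow>es. [:- e, 1:])"
  shows "\<exists>U. unitary n U \<and> A = U * mat_diag n (\<lambda>i. es ! i) * mat_adjoint U"
  using assms
proof (induction es arbitrary: n A)
  case Nil
  then have "n = 0" using degree_monic_char_poly[of A n] by auto
  then show ?case using Nil unitary_one[of n] by (intro exI[of _ "1\<^sub>m n"]) auto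
next
  case (Cons e es n A)
  note A = Cons.prems(1)
  have cp: "char_poly A = [: -e, 1 :] * (\<Prod>e \<leftarrow> es. [:- e, 1:])" using Cons.prems by auto
  have mon: "monic (\<Prod>e\<leftarrow> es. [:- e, 1:])" by (rule monic_prod_list) auto
  have "degree (char_poly A) = Suc (degree (\<Prod>e\<leftarrow> es. [:- e, 1:]))" unfolding cp
    by (subst degree_mult_eq, insert mon, auto)
  with degree_monic_char_poly[OF A] have n: "n \<noteq> 0" by auto
  then obtain k where k: "n = Suc k" by (cases n) auto
  have "eigenvalue A e" unfolding eigenvalue_root_char_poly[OF A] cp by simp
  then obtain v where v: "v \<in> carrier_vec n" "v \<noteq> 0\<^sub>v n" "A *\<^sub>v v = e \<cdot>\<^sub>v v"
    using A unfolding eigenvalue_def eigenvector_def by auto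
  from unitary_completion[OF v(1,2) n] obtain W c where
    W: "unitary n W" and c: "c \<noteq> 0" "col W 0 = c \<cdot>\<^sub>v v" by auto
  note Wc = unitaryD[OF W]
  define B where "B = mat_adjoint W * A * W"
  have B: "B \<in> carrier_mat n n" using Wc A unfolding B_def by auto
  have sB: "self_adjoint B" unfolding B_def by (rule self_adjoint_conj[OF A Cons.prems(2) Wc(1)])
  have AB: "A = W * B * mat_adjoint W"
  proof -
    have "W * B = A * W"
      unfolding B_def using Wc A unitary_cancel(2)[OF W, of "A * W" n]
      by (simp add: assoc_mult_mat[of _ n n _ n _ n])
    then show ?thesis using Wc A assoc_mult_mat[OF A Wc(1) Wc(2)] by simp
  qed
  have "col B 0 = mat_adjoint W *\<^sub>v (A *\<^sub>v col W 0)"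
    unfolding B_def assoc_mult_mat[OF Wc(2) A Wc(1)]
    using col_mult2[OF Wc(2) mult_carrier_mat[OF A Wc(1)]] col_mult2[OF A Wc(1)] n by simp
  also have "A *\<^sub>v col W 0 = e \<cdot>\<^sub>v col W 0"
    using v A unfolding c by (auto simp: mult_mat_vec[of A n n] smult_smult_assoc mult_ac)
  also have "mat_adjoint W *\<^sub>v (e \<cdot>\<^sub>v col W 0) = e \<cdot>\<^sub>v (mat_adjoint W *\<^sub>v col W 0)"
    using Wc by (intro mult_mat_vec) auto
  also have "mat_adjoint W *\<^sub>v col W 0 = col (mat_adjoint W * W) 0"
    using Wc n col_mult2[OF Wc(2) Wc(1), of 0] by simp
  finally have colB: "col B 0 = e \<cdot>\<^sub>v unit_vec n 0" using Wc n by simp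
  have B0: "B $$ (i, 0) = (if i = 0 then e else 0)" if "i < n" for i
    using arg_cong[OF colB, of "\<lambda>v. v $ i"] that B n by auto
  have B0': "B $$ (0, j) = (if j = 0 then e else 0)" if "j < n" for j
  proof -
    have "B $$ (0, j) = cnj (B $$ (j, 0))"
      by (rule self_adjoint_nth[OF sB B]) (use that n in auto)
    moreover have "B $$ (0,0) = e" using B0 n by simp
    ultimately show ?thesis using B0[OF that] by auto
  qed
  define B' where "B' = mat k k (\<lambda>(i, j). B $$ (Suc i, Suc j))"
  have B': "B' \<in> carrier_mat k k" unfolding B'_def by simp
  have sB': "self_adjoint B'" unfolding self_adjoint_def
  proof (rule eq_matI)
    fix i j assume "i < dim_row B'" "j < dim_col B'"
    then have ij: "i < k" "j < k" using B' by auto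
    then show "mat_adjoint B' $$ (i, j) = B' $$ (i, j)"
      using self_adjoint_nth[OF sB B, of "Suc i" "Suc j"] k by (simp add: B'_def)
  qed (use B' in auto)
  define E where "E = mat 1 1 (\<lambda>_. e)"
  have blk: "B = four_block_mat E (0\<^sub>m 1 k) (0\<^sub>m k 1) B'"
    by (rule eq_matI) (use B B' k B0 B0' in \<open>auto simp: E_def B'_def four_block_mat_def Let_def\<close>)
  have "char_poly A = char_poly B"
    unfolding AB by (rule char_poly_similar[OF similar_unitary[OF W B]])
  also have "\<dots> = char_poly E * char_poly B'"
    unfolding blk by (rule char_poly_four_block_zeros_col) (use B' in \<open>auto simp: E_def\<close>)
  also have "char_poly E = [:-e, 1:]"
    by (simp add: E_def char_poly_defs det_def sign_def)
  finally have "char_poly B' = (\<Prod>e\<leftarrow>es. [:- e, 1:])"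
    unfolding cp by (metis mult_cancel_left pCons_eq_0_iff zero_neq_one)
  from Cons.IH[OF B' sB' this] obtain U where
    U: "unitary k U" and BU: "B' = U * mat_diag k (\<lambda>i. es ! i) * mat_adjoint U" by auto
  note Uc = unitaryD[OF U]
  define V where "V = four_block_mat (1\<^sub>m 1) (0\<^sub>m 1 k) (0\<^sub>m k 1) U"
  have Vc: "V \<in> carrier_mat n n" using Uc k unfolding V_def by auto
  have Va: "mat_adjoint V = four_block_mat (1\<^sub>m 1) (0\<^sub>m 1 k) (0\<^sub>m k 1) (mat_adjoint U)"
    by (rule eq_matI) (use Uc k in \<open>auto simp: V_def four_block_mat_def Let_def\<close>)
  have V: "unitary n V"
    unfolding unitary_def Va using Vc Uc k unfolding V_def
    using block_diag_mult[OF one_carrier_mat[of 1] one_carrier_mat[of 1] Uc(2) Uc(1)] by simp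
  have D: "mat_diag n (\<lambda>i. (e # es) ! i) = four_block_mat E (0\<^sub>m 1 k) (0\<^sub>m k 1) (mat_diag k (\<lambda>i. es ! i))"
    by (rule eq_matI) (use k in \<open>auto simp: E_def four_block_mat_def Let_def mat_diag_def nth_Cons'\<close>)
  have Dc: "mat_diag k (\<lambda>i. es ! i) \<in> carrier_mat k k" by simp
  have E: "E \<in> carrier_mat 1 1" unfolding E_def by simp
  have "B = V * mat_diag n (\<lambda>i. (e # es) ! i) * mat_adjoint V"
    unfolding D Va unfolding V_def blk BU
    using block_diag_mult[OF one_carrier_mat[of 1] E Uc(1) Dc] E
      block_diag_mult[OF E one_carrier_mat[of 1] mult_carrier_mat[OF Uc(1) Dc] Uc(2)] by simp
  then have "A = W * (V * mat_diag n (\<lambda>i. (e # es) ! i) * mat_adjoint V) * mat_adjoint W"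
    using AB by simp
  also have "\<dots> = (W * V) * mat_diag n (\<lambda>i. (e # es) ! i) * mat_adjoint (W * V)"
    using mult_assoc_nested[OF Wc(1) Vc mat_diag_dim mat_adjoint_carrier[OF Vc] Wc(2)]
    by (simp only: mat_adjoint_mult[OF Wc(1) Vc])
  finally show ?case using unitary_mult[OF W V] by blast
qed

text \<open>
  The columns of \<open>U\<close> are an orthonormal eigenbasis, and \<open>mat_adjoint U *\<^sub>v v\<close> is the coordinate vector
  of \<open>v\<close> in it.  Eigenvalues are numbered from \<open>1\<close>, columns from \<open>0\<close>.
\<close>
definition diagonalizes :: "nat \<Rightarrow> complex mat \<Rightarrow> (nat \<Rightarrow> real) \<Rightarrow> complex mat \<Rightarrow> bool" where
  "diagonalizes N U a A \<longleftrightarrow> unitary N U \<and>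
     A = U * mat_diag N (\<lambda>i. complex_of_real (a (Suc i))) * mat_adjoint U"

lemma diagonalizesD:
  assumes "diagonalizes N U a A"
  shows "unitary N U" "A = U * mat_diag N (\<lambda>i. complex_of_real (a (Suc i))) * mat_adjoint U"
    "A \<in> carrier_mat N N"
proof -
  show U: "unitary N U" and A: "A = U * mat_diag N (\<lambda>i. complex_of_real (a (Suc i))) * mat_adjoint U"
    using assms unfolding diagonalizes_def by auto
  show "A \<in> carrier_mat N N" unfolding A using unitaryD[OF U] by auto
qed

lemma diagonalizes_self_adjoint: "diagonalizes N U a A \<Longrightarrow> self_adjoint A"
  using self_adjoint_conj[of "mat_diag N (\<lambda>i. complex_of_real (a (Suc i)))" N "mat_adjoint U"]
    diagonalizesD(2)[of N U a A] unitaryD[OF diagonalizesD(1), of N U a A]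
  by (simp add: self_adjoint_def)

lemma proots_linear_factors: "proots (\<Prod>e\<leftarrow>es. [:- e, 1:]) = mset es" for es :: "'a :: idom list"
proof (induction es)
  case (Cons e es)
  have "[:- e, 1:] \<noteq> 0" "(\<Prod>e\<leftarrow>es. [:- e, 1:]) \<noteq> 0"
    by (auto simp: prod_list_zero_iff)
  from proots_mult[OF this] Cons.IH show ?case by (simp del: mult_pCons_left)
qed simp

lemma has_spectrum_iff_char_poly:
  assumes A: "A \<in> carrier_mat N N"
  shows "has_spectrum N A a \<longleftrightarrow> char_poly A = (\<Prod>m=1..N. [:- complex_of_real (a m), 1:])"
proof -
  obtain es where es: "char_poly A = (\<Prod>e\<leftarrow>es. [:- e, 1:])"
    using char_poly_factorized[OF A] by auto
  note roots = proots_linear_factors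
  have prod: "(\<Prod>e\<leftarrow>es. [:- e, 1:]) = prod_mset (image_mset (\<lambda>e. [:- e, 1:]) (mset es))"
    for es :: "complex list"
    by (simp flip: prod_mset_prod_list mset_map)
  have aprod: "(\<Prod>m=1..N. [:- complex_of_real (a m), 1:]) =
      prod_mset (image_mset (\<lambda>e. [:- e, 1:]) (image_mset (\<lambda>n. complex_of_real (a n)) (mset_set {1..N})))"
    by (simp add: prod_unfold_prod_mset image_mset.compositionality o_def)
  have aprod': "(\<Prod>m=1..N. [:- complex_of_real (a m), 1:]) =
      (\<Prod>e\<leftarrow>map (\<lambda>n. complex_of_real (a n)) [1..<Suc N]. [:- e, 1:])"
    unfolding aprod prod by (simp del: upt_Suc add: mset_upt atLeastLessThanSuc_atLeastAtMost)
  show ?thesis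
  proof
    assume "has_spectrum N A a"
    then show "char_poly A = (\<Prod>m=1..N. [:- complex_of_real (a m), 1:])"
      unfolding has_spectrum_def aprod es roots unfolding prod by simp
  next
    assume "char_poly A = (\<Prod>m=1..N. [:- complex_of_real (a m), 1:])"
    then show "has_spectrum N A a"
      unfolding has_spectrum_def aprod' by (simp only: roots)
        (simp only: mset_map mset_upt atLeastLessThanSuc_atLeastAtMost)
  qed
qed

lemma diagonalizes_has_spectrum:
  assumes "diagonalizes N U a A"
  shows "has_spectrum N A a"
proof -
  let ?D = "mat_diag N (\<lambda>i. complex_of_real (a (Suc i)))"
  have D: "?D \<in> carrier_mat N N" by simp
  have "char_poly A = char_poly ?D"
    using char_poly_similar[OF similar_unitary[OF diagonalizesD(1)[OF assms] D]]
      diagonalizesD(2)[OF assms] by simp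
  also have "\<dots> = (\<Prod>e\<leftarrow>diag_mat ?D. [:- e, 1:])"
    by (rule char_poly_upper_triangular[OF D]) (auto simp: mat_diag_def)
  also have "diag_mat ?D = map (\<lambda>i. complex_of_real (a (Suc i))) [0..<N]"
    by (auto simp: diag_mat_def mat_diag_def)
  also have "(\<Prod>e\<leftarrow>map (\<lambda>i. complex_of_real (a (Suc i))) [0..<N]. [:- e, 1:]) =
      (\<Prod>i<N. [:- complex_of_real (a (Suc i)), 1:])"
    by (simp add: o_def prod.distinct_set_conv_list[symmetric] lessThan_atLeast0)
  also have "\<dots> = (\<Prod>m=1..N. [:- complex_of_real (a m), 1:])"
    by (rule prod.reindex_bij_witness[of _ "\<lambda>m. m - 1" Suc]) auto
  finally show ?thesis using has_spectrum_iff_char_poly diagonalizesD(3)[OF assms] by blast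
qed

theorem spectral_theorem:
  assumes A: "A \<in> carrier_mat N N" "self_adjoint A" and "has_spectrum N A a"
  shows "\<exists>U. diagonalizes N U a A"
proof -
  let ?es = "map (\<lambda>i. complex_of_real (a (Suc i))) [0..<N]"
  have "char_poly A = (\<Prod>m=1..N. [:- complex_of_real (a m), 1:])"
    using has_spectrum_iff_char_poly[OF A(1)] assms(3) by simp
  also have "\<dots> = (\<Prod>i<N. [:- complex_of_real (a (Suc i)), 1:])"
    by (rule prod.reindex_bij_witness[of _ Suc "\<lambda>m. m - 1"]) auto
  also have "\<dots> = (\<Prod>e\<leftarrow>?es. [:- e, 1:])"
    by (simp add: o_def prod.distinct_set_conv_list[symmetric] lessThan_atLeast0)
  finally obtain U where U: "unitary N U" "A = U * mat_diag N (\<lambda>i. ?es ! i) * mat_adjoint U"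
    using spectral_theorem_list[OF A] by blast
  have "mat_diag N (\<lambda>i. ?es ! i) = mat_diag N (\<lambda>i. complex_of_real (a (Suc i)))"
    by (rule eq_matI) (auto simp: mat_diag_def)
  then show ?thesis using U unfolding diagonalizes_def by auto
qed

text \<open>
  Over \<open>\<complex>\<close> the characteristic polynomial splits, and diagonalising with its roots in arbitrary order
  yields a self-adjoint diagonal matrix, so the roots are real and can be sorted.
\<close>
lemma self_adjoint_sorted_spectrum:
  assumes A: "A \<in> carrier_mat N N" "self_adjoint A"
  shows "\<exists>a. antimono_on {1..N} a \<and> has_spectrum N A a"
proof -
  obtain es where es: "char_poly A = (\<Prod>e\<leftarrow>es. [:- e, 1:])" and len: "length es = N"
    using char_poly_factorized[OF A(1)] by auto
  from spectral_theorem_list[OF A es] obtain U where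
    U: "unitary N U" and AU: "A = U * mat_diag N (\<lambda>i. es ! i) * mat_adjoint U" by auto
  let ?D = "mat_diag N (\<lambda>i. es ! i)"
  note Uc = unitaryD[OF U]
  have Dc: "?D \<in> carrier_mat N N" by simp
  have "mat_adjoint U * A * U = ?D" unfolding AU by (rule unitary_conj_inverse[OF U Dc])
  then have sD: "self_adjoint ?D" using self_adjoint_conj[OF A Uc(1)] by simp
  have real: "complex_of_real (Re (es ! i)) = es ! i" if "i < N" for i
  proof -
    have "cnj (es ! i) = es ! i"
      using self_adjoint_nth[OF sD Dc that that] that by (simp add: mat_diag_def)
    then show ?thesis by (simp add: complex_eq_iff)
  qed
  define xs where "xs = rev (sort (map Re es))"
  have lx: "length xs = N" using len unfolding xs_def by simp
  have sx: "sorted_wrt (\<ge>) xs" unfolding xs_def by (simp add: sorted_wrt_rev)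
  define a where "a m = xs ! (m - 1)" for m
  have "antimono_on {1..N} a"
  proof (intro monotone_onI)
    fix i j :: nat assume "i \<in> {1..N}" "j \<in> {1..N}" "i \<le> j"
    then have "i = j \<or> i - 1 < j - 1 \<and> j - 1 < length xs" using lx by auto
    then show "a j \<le> a i" using sx unfolding a_def sorted_wrt_iff_nth_less by auto
  qed
  moreover have "has_spectrum N A a"
  proof -
    have "map (\<lambda>n. a n) [1..<Suc N] = xs"
      unfolding a_def using lx by (intro nth_equalityI) (auto simp del: upt_Suc)
    then have "image_mset a (mset_set {1..N}) = mset (map Re es)"
      unfolding xs_def by (metis mset_map mset_rev mset_sort mset_upt atLeastLessThanSuc_atLeastAtMost)
    then have "image_mset complex_of_real (image_mset a (mset_set {1..N})) = mset (map (\<lambda>z. complex_of_real (Re z)) es)"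
      by (simp add: image_mset.compositionality o_def)
    also have "map (\<lambda>z. complex_of_real (Re z)) es = es"
      using real len by (intro nth_equalityI) auto
    finally have "image_mset (\<lambda>n. complex_of_real (a n)) (mset_set {1..N}) = mset es"
      by (simp add: image_mset.compositionality o_def)
    then show ?thesis unfolding has_spectrum_def es proots_linear_factors by simp
  qed
  ultimately show ?thesis by blast
qed

lemma sum_spectrum_eq_sum_diagonal:
  assumes "diagonalizes N U a A"
  shows "(\<Sum>i<N. A $$ (i, i)) = complex_of_real (\<Sum>m=1..N. a m)"
proof -
  let ?d = "\<lambda>i. complex_of_real (a (Suc i))"
  note U = diagonalizesD(1)[OF assms]
  note Uc = unitaryD[OF U]
  have "(\<Sum>i<N. A $$ (i, i)) = (\<Sum>i<N. \<Sum>k<N. U $$ (i, k) * ?d k * cnj (U $$ (i, k)))"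
    unfolding diagonalizesD(2)[OF assms] using Uc(1)
    by (intro sum.cong refl) (subst mat_diag_mult_right[OF Uc(1)],
      auto simp: scalar_prod_def lessThan_atLeast0 intro!: sum.cong)
  also have "\<dots> = (\<Sum>k<N. ?d k * (\<Sum>i<N. cnj (U $$ (i, k)) * U $$ (i, k)))"
    by (subst sum.swap) (simp add: sum_distrib_left mult_ac)
  also have "\<dots> = (\<Sum>k<N. ?d k)"
    by (intro sum.cong refl) (simp add: unitary_adjoint_nth[OF U])
  also have "\<dots> = (\<Sum>m=1..N. complex_of_real (a m))"
    by (rule sum.reindex_bij_witness[of _ "\<lambda>m. m - 1" Suc]) auto
  finally show ?thesis by simp
qed

lemma mat_diag_mult_vec:
  "v \<in> carrier_vec n \<Longrightarrow> i < n \<Longrightarrow> (mat_diag n d *\<^sub>v v) $ i = d i * v $ i" for v :: "complex vec"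
proof -
  assume v: "v \<in> carrier_vec n" and i: "i < n"
  have "(mat_diag n d *\<^sub>v v) $ i = (\<Sum>j<n. (if i = j then d j else 0) * v $ j)"
    using v i by (auto simp: mat_diag_def scalar_prod_def lessThan_atLeast0)
  also have "\<dots> = (\<Sum>j<n. if i = j then d j * v $ j else 0)"
    by (intro sum.cong) auto
  finally have "(mat_diag n d *\<^sub>v v) $ i = (\<Sum>j<n. if i = j then d j * v $ j else 0)" .
  then show ?thesis using i by simp
qed

lemma diagonalizes_adjoint_mult_vec:
  assumes A: "diagonalizes N U a A" and v: "v \<in> carrier_vec N" and i: "i < N"
  shows "(mat_adjoint U *\<^sub>v (A *\<^sub>v v)) $ i = complex_of_real (a (Suc i)) * (mat_adjoint U *\<^sub>v v) $ i"
proof -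
  note U = diagonalizesD(1)[OF A] and Ae = diagonalizesD(2)[OF A]
  let ?D = "mat_diag N (\<lambda>i. complex_of_real (a (Suc i)))"
  note Uc = unitaryD[OF U]
  have D: "?D \<in> carrier_mat N N" by simp
  have "A *\<^sub>v v = U *\<^sub>v (?D *\<^sub>v (mat_adjoint U *\<^sub>v v))"
    unfolding Ae using Uc v D
    by (simp add: assoc_mult_mat_vec[of _ N N _ N] mult_mat_vec_carrier[of _ N N] mult_carrier_mat[of _ N N _ N])
  then have "mat_adjoint U *\<^sub>v (A *\<^sub>v v) = ?D *\<^sub>v (mat_adjoint U *\<^sub>v v)"
    using unitary_cancel(3)[OF U] Uc v D by (simp add: mult_mat_vec_carrier[of _ N N])
  then show ?thesis using mat_diag_mult_vec[of "mat_adjoint U *\<^sub>v v" N i] i Uc v by simp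
qed

lemma quadratic_form:
  assumes A: "diagonalizes N U a A" and v: "v \<in> carrier_vec N"
  shows "(A *\<^sub>v v) \<bullet>c v =
    complex_of_real (\<Sum>i<N. a (Suc i) * (cmod ((mat_adjoint U *\<^sub>v v) $ i))\<^sup>2)"
proof -
  note U = diagonalizesD(1)[OF A]
  note Uc = unitaryD[OF U]
  have Av: "A *\<^sub>v v \<in> carrier_vec N" using diagonalizesD(3)[OF A] v by simp
  have "(A *\<^sub>v v) \<bullet>c v = (mat_adjoint U *\<^sub>v (A *\<^sub>v v)) \<bullet>c (mat_adjoint U *\<^sub>v v)"
    using unitary_inner[OF unitary_adjoint[OF U] Av v] by simp
  also have "\<dots> = (\<Sum>i<N. (mat_adjoint U *\<^sub>v (A *\<^sub>v v)) $ i * cnj ((mat_adjoint U *\<^sub>v v) $ i))"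
    using Uc by (simp add: scalar_prod_def lessThan_atLeast0)
  also have "\<dots> = (\<Sum>i<N. complex_of_real (a (Suc i) * (cmod ((mat_adjoint U *\<^sub>v v) $ i))\<^sup>2))"
    by (intro sum.cong refl)
       (simp only: diagonalizes_adjoint_mult_vec[OF A v] lessThan_iff of_real_mult complex_norm_square mult.assoc)
  finally show ?thesis by simp
qed

section \<open>The characteristic polynomial of a rank-one update\<close>

text \<open>
  Sylvester's identity.  The block matrix with rows \<open>(1, F)\<close> and \<open>(G, 1)\<close> becomes block triangular
  when either off-diagonal block is cleared by a column operation of determinant \<open>1\<close>; the two ways
  give the two sides.  The square case yields \<open>char_poly (F * G) = char_poly (G * F)\<close>, and the case
  \<open>m = 1\<close> is the matrix determinant lemma.
\<close>
theorem det_one_minus_mult_commute: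
  fixes F G :: "'a :: idom mat"
  assumes F: "F \<in> carrier_mat n m" and G: "G \<in> carrier_mat m n"
  shows "det (1\<^sub>m n - F * G) = det (1\<^sub>m m - G * F)"
proof -
  let ?M = "four_block_mat (1\<^sub>m n) F G (1\<^sub>m m)"
  let ?L = "four_block_mat (1\<^sub>m n) (0\<^sub>m n m) (- G) (1\<^sub>m m)"
  let ?R = "four_block_mat (1\<^sub>m n) (- F) (0\<^sub>m m n) (1\<^sub>m m)"
  have M: "?M \<in> carrier_mat (n + m) (n + m)" "?L \<in> carrier_mat (n + m) (n + m)"
    "?R \<in> carrier_mat (n + m) (n + m)" using F G by auto
  have mG: "- G \<in> carrier_mat m n" and mF: "- F \<in> carrier_mat n m"
    and FG: "F * G \<in> carrier_mat n n" and GF: "G * F \<in> carrier_mat m m" using F G by auto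
  have dL: "det ?L = 1"
    by (subst det_four_block_mat_upper_right_zero[OF one_carrier_mat refl mG one_carrier_mat]) simp
  have dR: "det ?R = 1"
    by (subst det_four_block_mat_lower_left_zero[OF one_carrier_mat mF refl one_carrier_mat]) simp
  have eL: "?M * ?L = four_block_mat (1\<^sub>m n - F * G) F (0\<^sub>m m n) (1\<^sub>m m)"
    by (subst mult_four_block_mat[OF one_carrier_mat F G one_carrier_mat one_carrier_mat
          zero_carrier_mat mG one_carrier_mat], rule cong_four_block_mat)
       (use F G in \<open>auto intro!: eq_matI\<close>)
  have eR: "?M * ?R = four_block_mat (1\<^sub>m n) (0\<^sub>m n m) G (1\<^sub>m m - G * F)"
    by (subst mult_four_block_mat[OF one_carrier_mat F G one_carrier_mat one_carrier_mat
          mF zero_carrier_mat one_carrier_mat], rule cong_four_block_mat)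
       (use F G in \<open>auto intro!: eq_matI\<close>)
  have "det ?M = det (1\<^sub>m n - F * G)"
    using det_mult[OF M(1,2)] unfolding dL eL
    by (subst (asm) det_four_block_mat_lower_left_zero[OF minus_carrier_mat[OF FG] F refl one_carrier_mat]) simp
  moreover have "det ?M = det (1\<^sub>m m - G * F)"
    using det_mult[OF M(1,3)] unfolding dR eR
    by (subst (asm) det_four_block_mat_upper_right_zero[OF one_carrier_mat refl G minus_carrier_mat[OF GF]]) simp
  ultimately show ?thesis by simp
qed

lemma poly_char_poly_det:
  fixes A :: "'a :: field mat"
  assumes "A \<in> carrier_mat n n"
  shows "poly (char_poly A) x = det (x \<cdot>\<^sub>m 1\<^sub>m n - A)"
proof -
  have "- char_matrix A x = x \<cdot>\<^sub>m 1\<^sub>m n - A"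
    using assms by (intro eq_matI) (auto simp: char_matrix_def)
  then show ?thesis using char_poly_matrix[OF assms, of x] by simp
qed

lemma char_poly_mult_commute:
  fixes F G :: "complex mat"
  assumes F: "F \<in> carrier_mat n n" and G: "G \<in> carrier_mat n n"
  shows "char_poly (F * G) = char_poly (G * F)"
proof -
  have eq: "poly (char_poly (F * G)) x = poly (char_poly (G * F)) x" if x: "x \<noteq> 0" for x
  proof -
    have FG: "F * G \<in> carrier_mat n n" and GF: "G * F \<in> carrier_mat n n"
      and F': "inverse x \<cdot>\<^sub>m F \<in> carrier_mat n n" using F G by auto
    have "x \<cdot>\<^sub>m 1\<^sub>m n - F * G = x \<cdot>\<^sub>m (1\<^sub>m n - (inverse x \<cdot>\<^sub>m F) * G)"
      unfolding mult_smult_assoc_mat[OF F G] using F G x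
      by (intro eq_matI) (auto simp: field_simps)
    moreover have "x \<cdot>\<^sub>m 1\<^sub>m n - G * F = x \<cdot>\<^sub>m (1\<^sub>m n - G * (inverse x \<cdot>\<^sub>m F))"
      unfolding mult_smult_distrib[OF G F] using F G x
      by (intro eq_matI) (auto simp: field_simps)
    ultimately show ?thesis
      using det_one_minus_mult_commute[OF F' G] F G
      by (simp add: poly_char_poly_det[OF FG] poly_char_poly_det[OF GF] det_smult)
  qed
  show ?thesis
  proof (rule ccontr)
    assume "char_poly (F * G) \<noteq> char_poly (G * F)"
    then have "finite {x. poly (char_poly (F * G) - char_poly (G * F)) x = 0}"
      by (intro poly_roots_finite) simp
    moreover have "- {0} \<subseteq> {x. poly (char_poly (F * G) - char_poly (G * F)) x = 0}"
      using eq by auto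
    ultimately have "finite (- {0 :: complex})" by (rule finite_subset[rotated])
    then show False using infinite_UNIV_char_0[where 'a = complex] by (simp add: finite_compl)
  qed
qed

definition outer :: "complex vec \<Rightarrow> complex mat" where
  "outer f = mat (dim_vec f) (dim_vec f) (\<lambda>(i, j). f $ i * cnj (f $ j))"

lemma outer_carrier [simp]: "f \<in> carrier_vec n \<Longrightarrow> outer f \<in> carrier_mat n n"
  unfolding outer_def by auto

lemma det_diag: "det (mat_diag n d) = (\<Prod>i<n. d i)" for d :: "nat \<Rightarrow> complex"
proof -
  have "det (mat_diag n d) = prod_list (diag_mat (mat_diag n d))"
    by (rule det_upper_triangular) (auto simp: mat_diag_def)
  also have "\<dots> = (\<Prod>i<n. d i)"
    by (simp add: diag_mat_def mat_diag_def prod.distinct_set_conv_list[symmetric] lessThan_atLeast0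
        cong: map_cong)
  finally show ?thesis .
qed

lemma det_unitary_conj:
  assumes U: "unitary n U" and X: "X \<in> carrier_mat n n"
  shows "det (U * X * mat_adjoint U) = det X"
  by (rule det_similar[OF similar_unitary[OF U X]])

lemma outer_conj:
  assumes U: "unitary n U" and g: "g \<in> carrier_vec n"
  shows "outer (U *\<^sub>v g) = U * outer g * mat_adjoint U"
proof (rule eq_matI)
  note Uc = unitaryD[OF U]
  fix i j assume "i < dim_row (U * outer g * mat_adjoint U)" "j < dim_col (U * outer g * mat_adjoint U)"
  then have ij: "i < n" "j < n" using Uc by auto
  have "(U * outer g * mat_adjoint U) $$ (i, j) =
      (\<Sum>l<n. (\<Sum>k<n. U $$ (i, k) * (g $ k * cnj (g $ l))) * cnj (U $$ (j, l)))"
    using ij Uc g by (auto simp: scalar_prod_def lessThan_atLeast0 outer_def intro!: sum.cong)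
  also have "\<dots> = (\<Sum>k<n. U $$ (i, k) * g $ k) * cnj (\<Sum>l<n. U $$ (j, l) * g $ l)"
    by (simp only: sum_distrib_left cnj_sum, intro sum.cong refl)
       (simp add: sum_distrib_left sum_distrib_right mult_ac)
  also have "\<dots> = outer (U *\<^sub>v g) $$ (i, j)"
    using ij Uc g by (simp add: outer_def scalar_prod_def lessThan_atLeast0)
  finally show "outer (U *\<^sub>v g) $$ (i, j) = (U * outer g * mat_adjoint U) $$ (i, j)" ..
qed (use unitaryD[OF U] g in \<open>auto simp: outer_def\<close>)

text \<open>
  Factoring out the diagonal matrix leaves the identity minus a column times a row, whose
  determinant is that of a \<open>1 \<times> 1\<close> matrix.
\<close>
lemma det_diag_minus_outer:
  assumes g: "g \<in> carrier_vec n" and d: "\<And>i. i < n \<Longrightarrow> d i \<noteq> 0"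
  shows "det (mat_diag n d - outer g) = (\<Prod>i<n. d i) * (1 - (\<Sum>i<n. g $ i * cnj (g $ i) / d i))"
proof -
  define F where "F = mat n 1 (\<lambda>(i, _). g $ i / d i)"
  define G where "G = mat 1 n (\<lambda>(_, i). cnj (g $ i))"
  have F: "F \<in> carrier_mat n 1" and G: "G \<in> carrier_mat 1 n" unfolding F_def G_def by auto
  have FG: "1\<^sub>m n - F * G \<in> carrier_mat n n" using F G by auto
  have "mat_diag n d - outer g = mat_diag n d * (1\<^sub>m n - F * G)"
    unfolding mat_diag_mult_left[OF FG]
    by (rule eq_matI) (use g d in \<open>auto simp: mat_diag_def F_def G_def outer_def scalar_prod_def algebra_simps\<close>)
  then have "det (mat_diag n d - outer g) = (\<Prod>i<n. d i) * det (1\<^sub>m 1 - G * F)"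
    using det_mult[OF mat_diag_dim FG, of d] by (simp only: det_diag det_one_minus_mult_commute[OF F G])
  also have "1\<^sub>m 1 - G * F \<in> carrier_mat 1 1" using F G by auto
  then have "det (1\<^sub>m 1 - G * F) = (1\<^sub>m 1 - G * F) $$ (0, 0)" by (rule det_single)
  also have "\<dots> = 1 - (\<Sum>i<n. g $ i * cnj (g $ i) / d i)"
    by (simp add: F_def G_def scalar_prod_def lessThan_atLeast0 mult_ac)
  finally show ?thesis .
qed

lemma char_matrix_diagonalizes:
  assumes A: "diagonalizes N U a A"
  shows "complex_of_real x \<cdot>\<^sub>m 1\<^sub>m N - A =
    U * mat_diag N (\<lambda>i. complex_of_real (x - a (Suc i))) * mat_adjoint U"
proof -
  note U = unitaryD[OF diagonalizesD(1)[OF A]]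
  let ?D = "mat_diag N (\<lambda>i. complex_of_real (a (Suc i)))"
  have D: "?D \<in> carrier_mat N N" by simp
  have x: "complex_of_real x \<cdot>\<^sub>m 1\<^sub>m N \<in> carrier_mat N N" by simp
  have split: "mat_diag N (\<lambda>i. complex_of_real (x - a (Suc i))) = complex_of_real x \<cdot>\<^sub>m 1\<^sub>m N - ?D"
    by (rule eq_matI) (auto simp: mat_diag_def)
  show ?thesis
    unfolding split mult_minus_distrib_mat[OF U(1) x D]
      minus_mult_distrib_mat[OF mult_carrier_mat[OF U(1) x] mult_carrier_mat[OF U(1) D] U(2)]
    using diagonalizesD(2)[OF A] unitary_conj_scalar[OF diagonalizesD(1)[OF A]] by simp
qed

text \<open>
  The secular equation: conjugating by the eigenbasis turns \<open>x I - (A + f f\<^sup>*)\<close> into a diagonal matrix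
  minus the rank-one matrix of the coordinate vector of \<open>f\<close>.
\<close>
theorem rank_one_update_ratio:
  assumes A: "diagonalizes N U a A" and f: "f \<in> carrier_vec N"
    and B: "has_spectrum N (A + outer f) b"
    and x: "\<And>m. m \<in> {1..N} \<Longrightarrow> x \<noteq> a m"
  shows "(\<Prod>m=1..N. x - b m) / (\<Prod>m=1..N. x - a m) =
    1 - (\<Sum>i<N. (cmod ((mat_adjoint U *\<^sub>v f) $ i))\<^sup>2 / (x - a (Suc i)))"
proof -
  note U = diagonalizesD(1)[OF A]
  note Uc = unitaryD[OF U]
  let ?g = "mat_adjoint U *\<^sub>v f"
  let ?d = "\<lambda>i. complex_of_real (x - a (Suc i))"
  have g: "?g \<in> carrier_vec N" by (rule mult_mat_vec_carrier[OF Uc(2) f])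
  have Bc: "A + outer f \<in> carrier_mat N N" using f by auto
  have D: "mat_diag N ?d \<in> carrier_mat N N" and og: "outer ?g \<in> carrier_mat N N" using g by auto
  have "complex_of_real (\<Prod>m=1..N. x - b m) = poly (char_poly (A + outer f)) (complex_of_real x)"
    using B unfolding has_spectrum_iff_char_poly[OF Bc] by (simp add: poly_prod)
  also have "\<dots> = det (complex_of_real x \<cdot>\<^sub>m 1\<^sub>m N - (A + outer f))"
    by (rule poly_char_poly_det[OF Bc])
  also have "complex_of_real x \<cdot>\<^sub>m 1\<^sub>m N - (A + outer f) = (complex_of_real x \<cdot>\<^sub>m 1\<^sub>m N - A) - outer f"
    using f diagonalizesD(3)[OF A] by (intro eq_matI) (auto simp: outer_def)
  also have "\<dots> = U * (mat_diag N ?d - outer ?g) * mat_adjoint U"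
    using outer_conj[OF U g] unfolding unitary_cancel(4)[OF U f] char_matrix_diagonalizes[OF A]
    by (simp only: mult_minus_distrib_mat[OF Uc(1) D og]
      minus_mult_distrib_mat[OF mult_carrier_mat[OF Uc(1) D] mult_carrier_mat[OF Uc(1) og] Uc(2)])
  also have "det \<dots> = det (mat_diag N ?d - outer ?g)"
    by (rule det_unitary_conj[OF U]) (use og in auto)
  also have "\<dots> = (\<Prod>i<N. ?d i) * (1 - (\<Sum>i<N. ?g $ i * cnj (?g $ i) / ?d i))"
    by (rule det_diag_minus_outer[OF g]) (use x in auto)
  also have "\<dots> = complex_of_real ((\<Prod>i<N. x - a (Suc i)) *
      (1 - (\<Sum>i<N. (cmod (?g $ i))\<^sup>2 / (x - a (Suc i)))))"
    by (simp only: complex_norm_square[symmetric] of_real_mult of_real_prod of_real_diff of_real_1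
      of_real_sum of_real_divide)
  finally have "(\<Prod>m=1..N. x - b m) = (\<Prod>i<N. x - a (Suc i)) *
      (1 - (\<Sum>i<N. (cmod (?g $ i))\<^sup>2 / (x - a (Suc i))))"
    by (simp only: of_real_eq_iff)
  also have "(\<Prod>i<N. x - a (Suc i)) = (\<Prod>m=1..N. x - a m)"
    by (rule prod.reindex_bij_witness[of _ "\<lambda>m. m - 1" Suc]) auto
  finally show ?thesis using x by (simp add: prod_zero_iff)
qed

section \<open>Residues and projections onto eigenspaces\<close>

lemma mult_zero_vec: "A \<in> carrier_mat m n \<Longrightarrow> A *\<^sub>v 0\<^sub>v n = 0\<^sub>v m" for A :: "complex mat"
  by (rule eq_vecI) (auto intro: scalar_prod_right_zero)

lemma eigenspace_iff:
  assumes A: "diagonalizes N U a A"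
  shows "w \<in> mat_kernel (complex_of_real t \<cdot>\<^sub>m 1\<^sub>m N - A) \<longleftrightarrow>
    w \<in> carrier_vec N \<and> (\<forall>i<N. a (Suc i) \<noteq> t \<longrightarrow> (mat_adjoint U *\<^sub>v w) $ i = 0)"
proof -
  note U = diagonalizesD(1)[OF A]
  note Uc = unitaryD[OF U]
  let ?K = "complex_of_real t \<cdot>\<^sub>m 1\<^sub>m N - A"
  let ?D = "mat_diag N (\<lambda>i. complex_of_real (t - a (Suc i)))"
  have K: "?K \<in> carrier_mat N N" using diagonalizesD(3)[OF A] by auto
  have D: "?D \<in> carrier_mat N N" by simp
  have iff: "?K *\<^sub>v w = 0\<^sub>v N \<longleftrightarrow> (\<forall>i<N. a (Suc i) \<noteq> t \<longrightarrow> (mat_adjoint U *\<^sub>v w) $ i = 0)"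
    if w: "w \<in> carrier_vec N"
  proof -
    have g: "mat_adjoint U *\<^sub>v w \<in> carrier_vec N" by (rule mult_mat_vec_carrier[OF Uc(2) w])
    have Dg: "?D *\<^sub>v (mat_adjoint U *\<^sub>v w) \<in> carrier_vec N"
      using mult_mat_vec_carrier[OF D g] .
    have eq: "?K *\<^sub>v w = U *\<^sub>v (?D *\<^sub>v (mat_adjoint U *\<^sub>v w))"
      unfolding char_matrix_diagonalizes[OF A]
        assoc_mult_mat_vec[OF mult_carrier_mat[OF Uc(1) D] Uc(2) w]
        assoc_mult_mat_vec[OF Uc(1) D g] ..
    have "?K *\<^sub>v w = 0\<^sub>v N \<longleftrightarrow> ?D *\<^sub>v (mat_adjoint U *\<^sub>v w) = 0\<^sub>v N"
    proof
      assume "?K *\<^sub>v w = 0\<^sub>v N"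
      then have "?D *\<^sub>v (mat_adjoint U *\<^sub>v w) = mat_adjoint U *\<^sub>v 0\<^sub>v N"
        using unitary_cancel(3)[OF U Dg] eq by simp
      then show "?D *\<^sub>v (mat_adjoint U *\<^sub>v w) = 0\<^sub>v N" by (simp only: mult_zero_vec[OF Uc(2)])
    qed (simp only: eq mult_zero_vec[OF Uc(1)])
    also have "\<dots> \<longleftrightarrow> (\<forall>i<N. complex_of_real (t - a (Suc i)) * (mat_adjoint U *\<^sub>v w) $ i = 0)"
      using carrier_vecD[OF Dg] mat_diag_mult_vec[OF g] by (auto simp: vec_eq_iff simp del: dim_mult_mat_vec)
    finally show ?thesis by auto
  qed
  have "w \<in> mat_kernel ?K \<longleftrightarrow> w \<in> carrier_vec N \<and> ?K *\<^sub>v w = 0\<^sub>v N"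
    unfolding mat_kernel_def mem_Collect_eq carrier_matD[OF K] ..
  then show ?thesis using iff by blast
qed

text \<open>
  In eigenbasis coordinates the \<open>t\<close>-eigenspace is a coordinate subspace, so the projection keeps the
  coordinates belonging to \<open>t\<close> and erases the others.
\<close>
theorem norm_projection_eigenspace:
  assumes A: "diagonalizes N U a A" and f: "f \<in> carrier_vec N"
  shows "vec_norm_sq (orth_proj (mat_kernel (complex_of_real t \<cdot>\<^sub>m 1\<^sub>m N - A)) f) =
    (\<Sum>i \<in> {i. i < N \<and> a (Suc i) = t}. (cmod ((mat_adjoint U *\<^sub>v f) $ i))\<^sup>2)"
proof -
  note U = diagonalizesD(1)[OF A]
  note Uc = unitaryD[OF U]
  let ?W = "mat_kernel (complex_of_real t \<cdot>\<^sub>m 1\<^sub>m N - A)"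
  let ?g = "mat_adjoint U *\<^sub>v f"
  note W = eigenspace_iff[OF A, of _ t]
  define h where "h = vec N (\<lambda>i. if a (Suc i) = t then ?g $ i else 0)"
  have h: "h \<in> carrier_vec N" unfolding h_def by simp
  define p where "p = U *\<^sub>v h"
  have p: "p \<in> carrier_vec N" unfolding p_def using Uc h by auto
  have Up: "mat_adjoint U *\<^sub>v p = h" unfolding p_def by (rule unitary_cancel(3)[OF U h])
  have pW: "p \<in> ?W" unfolding W Up using p by (auto simp: h_def)
  have "orth_proj ?W f = p" unfolding orth_proj_def
  proof (rule the_equality, intro conjI ballI)
    show "p \<in> ?W" by (rule pW)
  next
    fix w assume "w \<in> ?W"
    then have w: "w \<in> carrier_vec N" and w0: "\<forall>i<N. a (Suc i) \<noteq> t \<longrightarrow> (mat_adjoint U *\<^sub>v w) $ i = 0"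
      unfolding W by auto
    have fp: "f - p \<in> carrier_vec N" using f p by auto
    have "(f - p) \<bullet>c w = (mat_adjoint U *\<^sub>v (f - p)) \<bullet>c (mat_adjoint U *\<^sub>v w)"
      using unitary_inner[OF unitary_adjoint[OF U] fp w] by simp
    also have "mat_adjoint U *\<^sub>v (f - p) = ?g - h"
      using mult_minus_distrib_mat_vec[OF Uc(2) f p] Up by simp
    also have "(?g - h) \<bullet>c u = 0" if "u \<in> carrier_vec N" "\<forall>i<N. a (Suc i) \<noteq> t \<longrightarrow> u $ i = 0" for u
      unfolding scalar_prod_def using that Uc(1) by (intro sum.neutral) (auto simp: h_def)
    from this[OF mult_mat_vec_carrier[OF Uc(2) w] w0] have "(?g - h) \<bullet>c (mat_adjoint U *\<^sub>v w) = 0" .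
    finally show "(f - p) \<bullet>c w = 0" .
  next
    fix q assume q: "q \<in> ?W \<and> (\<forall>w\<in>?W. (f - q) \<bullet>c w = 0)"
    then have qc: "q \<in> carrier_vec N" and q0: "\<forall>i<N. a (Suc i) \<noteq> t \<longrightarrow> (mat_adjoint U *\<^sub>v q) $ i = 0"
      unfolding W by auto
    have "mat_adjoint U *\<^sub>v q = h"
    proof (rule eq_vecI)
      fix i assume "i < dim_vec h"
      then have i: "i < N" unfolding h_def by simp
      show "(mat_adjoint U *\<^sub>v q) $ i = h $ i"
      proof (cases "a (Suc i) = t")
        case False
        then show ?thesis using q0 i unfolding h_def by simp
      next
        case True
        let ?e = "unit_vec N i :: complex vec"
        have e: "?e \<in> carrier_vec N" by simp
        have fq: "f - q \<in> carrier_vec N" using f qc by auto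
        have "U *\<^sub>v ?e \<in> ?W"
          unfolding W unitary_cancel(3)[OF U e] using Uc True i by auto
        then have "0 = (f - q) \<bullet>c (U *\<^sub>v ?e)" using q by simp
        also have "\<dots> = (mat_adjoint U *\<^sub>v (f - q)) \<bullet>c ?e"
          using adjoint_mult_vec_inner[OF Uc(2) fq e] by simp
        also have "mat_adjoint U *\<^sub>v (f - q) = ?g - mat_adjoint U *\<^sub>v q"
          by (rule mult_minus_distrib_mat_vec[OF Uc(2) f qc])
        also have "conjugate ?e = ?e" by (rule eq_vecI) (auto simp: unit_vec_def)
        also have "(?g - mat_adjoint U *\<^sub>v q) \<bullet> ?e = ?g $ i - (mat_adjoint U *\<^sub>v q) $ i"
          using i Uc by (subst scalar_prod_right_unit) auto
        finally show ?thesis using True i unfolding h_def by simp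
      qed
    qed (use Uc in \<open>simp add: h_def\<close>)
    then show "q = p" unfolding p_def using unitary_cancel(4)[OF U qc] by simp
  qed
  moreover have "vec_norm_sq p = vec_norm_sq h" unfolding p_def by (rule unitary_norm[OF U h])
  moreover have "vec_norm_sq h = (\<Sum>i<N. if a (Suc i) = t then (cmod (?g $ i))\<^sup>2 else 0)"
    unfolding vec_norm_sq_def h_def by (auto intro!: sum.cong)
  moreover have "\<dots> = (\<Sum>i \<in> {i. i < N \<and> a (Suc i) = t}. (cmod (?g $ i))\<^sup>2)"
    by (subst sum.inter_filter[symmetric]) auto
  ultimately show ?thesis by simp
qed

text \<open>
  At \<open>t\<close>, only the summands of the secular equation with a pole at \<open>t\<close> survive the multiplication by
  \<open>x - t\<close>.  When \<open>t\<close> is not an eigenvalue, the limit and the projection are \<open>0\<close>.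
\<close>
theorem rank_one_update_residue:
  assumes A: "A \<in> carrier_mat N N" "self_adjoint A" "has_spectrum N A a"
    and f: "f \<in> carrier_vec N" and B: "has_spectrum N (A + outer f) b"
  shows "((\<lambda>x. (x - t) * ((\<Prod>m=1..N. x - b m) / (\<Prod>m=1..N. x - a m))) \<longlongrightarrow>
    - vec_norm_sq (orth_proj (mat_kernel (complex_of_real t \<cdot>\<^sub>m 1\<^sub>m N - A)) f)) (at t)"
proof -
  obtain U where U: "diagonalizes N U a A" using spectral_theorem[OF A] by auto
  let ?c = "\<lambda>i. (cmod ((mat_adjoint U *\<^sub>v f) $ i))\<^sup>2"
  let ?r = "\<lambda>i. if a (Suc i) = t then ?c i else 0"
  have ev: "eventually (\<lambda>x. \<forall>m\<in>{1..N}. x \<noteq> a m) (at t)"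
    by (intro eventually_ball_finite ballI finite_atLeastAtMost)
       (metis eventually_at_topological open_UNIV UNIV_I eventually_neq_at_within)
  have summand: "((\<lambda>x. (x - t) * (?c i / (x - a (Suc i)))) \<longlongrightarrow> ?r i) (at t)" for i
  proof (cases "a (Suc i) = t")
    case True
    have "((\<lambda>x. ?c i) \<longlongrightarrow> ?c i) (at t)" by simp
    then have "((\<lambda>x. (x - t) * (?c i / (x - a (Suc i)))) \<longlongrightarrow> ?c i) (at t)"
      by (rule Lim_transform_eventually) (auto simp: True eventually_at_filter)
    then show ?thesis using True by simp
  next
    case False
    have "((\<lambda>x. (x - t) * (?c i / (x - a (Suc i)))) \<longlongrightarrow> (t - t) * (?c i / (t - a (Suc i)))) (at t)"
      by (intro tendsto_intros) (use False in auto)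
    then show ?thesis using False by simp
  qed
  have "((\<lambda>x. (x - t) - (\<Sum>i<N. (x - t) * (?c i / (x - a (Suc i))))) \<longlongrightarrow>
      (t - t) - (\<Sum>i<N. ?r i)) (at t)"
    by (intro tendsto_diff tendsto_sum summand tendsto_intros)
  moreover have "(\<Sum>i<N. ?r i) = vec_norm_sq (orth_proj (mat_kernel (complex_of_real t \<cdot>\<^sub>m 1\<^sub>m N - A)) f)"
    unfolding norm_projection_eigenspace[OF U f] by (subst sum.inter_filter[symmetric]) auto
  moreover have "eventually (\<lambda>x. (x - t) - (\<Sum>i<N. (x - t) * (?c i / (x - a (Suc i)))) =
      (x - t) * ((\<Prod>m=1..N. x - b m) / (\<Prod>m=1..N. x - a m))) (at t)"
    using ev
  proof eventually_elim
    case (elim x)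
    show ?case
      by (subst rank_one_update_ratio[OF U f B]) (use elim in \<open>auto simp: right_diff_distrib sum_distrib_left\<close>)
  qed
  ultimately show ?thesis by (auto intro: Lim_transform_eventually)
qed

text \<open>
  At a root of \<open>p\<close>, the vanishing of the limit forces the order of \<open>d\<close> to be at least that of \<open>p\<close>.
  Since \<open>p\<close> splits over the reals, \<open>d\<close> then has at least as many roots as the degree of \<open>p\<close>.
\<close>
lemma residues_vanish_imp_eq:
  fixes p d :: "real poly"
  assumes p: "p = (\<Prod>m\<in>M. [:- a m, 1:])" and fin: "finite M" and deg: "d = 0 \<or> degree d < card M"
    and lim: "\<And>t. t \<in> a ` M \<Longrightarrow> ((\<lambda>x. (x - t) * (poly d x / poly p x)) \<longlongrightarrow> 0) (at t)"
  shows "d = 0"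
proof (rule ccontr)
  assume d: "d \<noteq> 0"
  have p0: "p \<noteq> 0" unfolding p using fin by simp
  have ord: "order t p \<le> order t d" if t: "t \<in> a ` M" for t
  proof (rule ccontr)
    assume "\<not> order t p \<le> order t d"
    then obtain e where e: "order t p = Suc (order t d + e)" by (metis less_iff_Suc_add not_le)
    obtain d' where d': "d = [:- t, 1:] ^ order t d * d'" "\<not> [:- t, 1:] dvd d'"
      using order_decomp[OF d] by blast
    obtain p' where p': "p = [:- t, 1:] ^ order t p * p'" "\<not> [:- t, 1:] dvd p'"
      using order_decomp[OF p0] by blast
    (* The factor (x - t) ^ e cancels the excess order of p, so that the quotient would tend to the
       nonzero number d' t / p' t. *)
    have nz: "poly d' t \<noteq> 0" "poly p' t \<noteq> 0" using d'(2) p'(2) by (simp_all add: poly_eq_0_iff_dvd)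
    have "((\<lambda>x. (x - t) * (poly d x / poly p x) * (x - t) ^ e) \<longlongrightarrow> 0 * (t - t) ^ e) (at t)"
      by (intro tendsto_mult lim[OF t] tendsto_intros)
    moreover have "(x - t) * (poly d x / poly p x) * (x - t) ^ e = poly d' x / poly p' x" if "x \<noteq> t" for x
    proof -
      have pd: "poly d x = (x - t) ^ order t d * poly d' x"
        by (subst d'(1)) (simp add: poly_power)
      have pp: "poly p x = (x - t) * (x - t) ^ order t d * (x - t) ^ e * poly p' x"
        by (subst p'(1)) (simp only: poly_power poly_mult poly_pCons poly_0 e power_Suc power_add, simp)
      have "u * (s * y / (u * s * v * z)) * v = y / z" if "u \<noteq> 0" "s \<noteq> 0" "v \<noteq> 0"
        for u s v y z :: real using that by simp
      then show ?thesis unfolding pd pp by this (use that in auto)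
    qed
    ultimately have "((\<lambda>x. poly d' x / poly p' x) \<longlongrightarrow> 0) (at t)"
      by (auto intro: Lim_transform_eventually simp: eventually_at_filter)
    moreover have "((\<lambda>x. poly d' x / poly p' x) \<longlongrightarrow> poly d' t / poly p' t) (at t)"
      by (intro tendsto_intros) (use nz in auto)
    ultimately have "poly d' t / poly p' t = 0" by (intro tendsto_unique[of "at t"]) auto
    then show False using nz by simp
  qed
  have roots: "proots p = image_mset a (mset_set M)"
    unfolding p using fin by (subst proots_prod) (auto simp: sum_unfold_sum_mset)
  have "proots p \<subseteq># proots d"
  proof (rule mset_subset_eqI)
    fix t
    show "count (proots p) t \<le> count (proots d) t"
    proof (cases "t \<in> a ` M")
      case True then show ?thesis using ord p0 d by simp
    next
      case False
      then have "t \<notin># proots p" unfolding roots using fin by auto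
      then show ?thesis by (simp add: not_in_iff)
    qed
  qed
  then have "size (proots p) \<le> size (proots d)" by (rule size_mset_mono)
  also have "\<dots> \<le> degree d" by (rule size_proots_le)
  finally show False using deg d unfolding roots by simp
qed

text \<open>
  The existence of the limits matters: it excludes poles of order greater than one, so that the
  quotients are determined by their residues.
\<close>
theorem spectrum_determined_by_residues:
  fixes a b c :: "nat \<Rightarrow> real"
  assumes lim: "\<And>t. t \<in> a ` {1..N} \<Longrightarrow>
      ((\<lambda>x. (x - t) * ((\<Prod>m=1..N. x - b m) / (\<Prod>m=1..N. x - a m))) \<longlongrightarrow> r t) (at t)"
    "\<And>t. t \<in> a ` {1..N} \<Longrightarrow>
      ((\<lambda>x. (x - t) * ((\<Prod>m=1..N. x - c m) / (\<Prod>m=1..N. x - a m))) \<longlongrightarrow> r t) (at t)"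
  shows "image_mset b (mset_set {1..N}) = image_mset c (mset_set {1..N})"
proof -
  define P where "P e = (\<Prod>m=1..N. [:- e m, 1:])" for e :: "nat \<Rightarrow> real"
  have polyP: "poly (P e) x = (\<Prod>m=1..N. x - e m)" for e x unfolding P_def by (simp add: poly_prod)
  have roots: "proots (P e) = image_mset e (mset_set {1..N})" for e
    unfolding P_def by (subst proots_prod) (auto simp: sum_unfold_sum_mset)
  have monic: "degree (P e) = N \<and> lead_coeff (P e) = 1" for e
  proof
    show "degree (P e) = N" unfolding P_def by (simp add: degree_prod_eq_sum_degree)
    show "lead_coeff (P e) = 1" unfolding P_def lead_coeff_prod by simp
  qed
  have deg: "P b - P c = 0 \<or> degree (P b - P c) < card {1..N}"
  proof (cases "N = 0")
    case False
    have "degree (P b - P c) < N" 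
    proof (rule ccontr)
      assume "\<not> degree (P b - P c) < N"
      moreover have "degree (P b - P c) \<le> N" using degree_diff_le[of "P b" N "P c"] monic by simp
      ultimately have "degree (P b - P c) = N" by simp
      then have "lead_coeff (P b - P c) = 0" using monic[of b] monic[of c] by (metis coeff_diff diff_self)
      then show False using \<open>degree (P b - P c) = N\<close> False by (metis degree_0 leading_coeff_0_iff)
    qed
    then show ?thesis by simp
  qed (simp add: P_def)
  have "P b - P c = 0"
  proof (rule residues_vanish_imp_eq[OF P_def _ deg])
    fix t assume t: "t \<in> a ` {1..N}"
    have "((\<lambda>x. (x - t) * ((\<Prod>m=1..N. x - b m) / (\<Prod>m=1..N. x - a m)) -
        (x - t) * ((\<Prod>m=1..N. x - c m) / (\<Prod>m=1..N. x - a m))) \<longlongrightarrow> r t - r t) (at t)"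
      by (intro tendsto_diff lim t)
    then show "((\<lambda>x. (x - t) * (poly (P b - P c) x / poly (P a) x)) \<longlongrightarrow> 0) (at t)"
      by (simp add: polyP diff_divide_distrib right_diff_distrib)
  qed simp
  then show ?thesis using roots[of b] roots[of c] by simp
qed

section \<open>Interlacing\<close>

text \<open>
  The dimension count behind the Courant-Fischer theorem.  The vectors spanned by the first \<open>m + c\<close>
  eigenvectors of \<open>B\<close> satisfy \<open>\<langle>B v, v\<rangle> \<ge> b\<^bsub>m+c\<^esub> \<parallel>v\<parallel>\<^sup>2\<close>, and those orthogonal to the first \<open>m - 1\<close>
  eigenvectors of \<open>A\<close> satisfy \<open>\<langle>A v, v\<rangle> \<le> a\<^sub>m \<parallel>v\<parallel>\<^sup>2\<close>.  The latter and the \<open>c\<close> equations \<open>W v = 0\<close> are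
  \<open>m + c - 1\<close> linear conditions on a space of dimension \<open>m + c\<close>, hence some nonzero \<open>v\<close> satisfies
  all of them.
\<close>
theorem eigenvalue_comparison:
  assumes A: "diagonalizes N U a A" and B: "diagonalizes N V b B"
    and a: "antimono_on {1..N} a" and b: "antimono_on {1..N} b"
    and W: "W \<in> carrier_mat c N"
    and le: "\<And>v. v \<in> carrier_vec N \<Longrightarrow> W *\<^sub>v v = 0\<^sub>v c \<Longrightarrow>
      Re ((B *\<^sub>v v) \<bullet>c v) \<le> Re ((A *\<^sub>v v) \<bullet>c v)"
    and m: "1 \<le> m" "m + c \<le> N"
  shows "b (m + c) \<le> a m"
proof -
  note U = unitaryD[OF diagonalizesD(1)[OF A]] and V = unitaryD[OF diagonalizesD(1)[OF B]]
  define X where "X = mat_adjoint U * V"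
  define Y where "Y = W * V"
  have X: "X \<in> carrier_mat N N" unfolding X_def by (rule mult_carrier_mat[OF U(2) V(1)])
  have Y: "Y \<in> carrier_mat c N" unfolding Y_def by (rule mult_carrier_mat[OF W V(1)])
  (* The unknowns are the coordinates y of v in the eigenbasis of B.  The rows of M state, in order,
     the m - 1 orthogonality conditions, the c conditions W v = 0, nothing (the zero row), and that
     the coordinates from m + c on vanish.  The zero row makes M singular. *)
  define R where "R i = (if i < m - 1 then row X i else if i < m + c - 1 then row Y (i - (m - 1))
      else if i = m + c - 1 then 0\<^sub>v N else unit_vec N i)" for i
  define M where "M = mat\<^sub>r N N (\<lambda>i. if i = m + c - 1 then 0\<^sub>v N else R i)"
  have Rc: "R i \<in> carrier_vec N" if "i < N" for i
    using X Y that m unfolding R_def by auto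
  have M: "M \<in> carrier_mat N N"
    unfolding M_def by simp
  have rowM: "row M i = R i" if "i < N" for i
    unfolding M_def using that Rc[OF that] m by (subst row_mat_of_row_fun) (auto simp: R_def)
  have "det M = 0"
    unfolding M_def by (rule det_row_0) (use m Rc in auto)
  then obtain y where y: "y \<in> carrier_vec N" "y \<noteq> 0\<^sub>v N" "M *\<^sub>v y = 0\<^sub>v N"
    using det_0_iff_vec_prod_zero[OF M] by auto
  have Ry: "R i \<bullet> y = 0" if "i < N" for i
    using arg_cong[OF y(3), of "\<lambda>v. v $ i"] that M rowM by simp
  have y0: "y $ i = 0" if "m + c \<le> i" "i < N" for i
    using Ry[of i] that y(1) m unfolding R_def by (auto split: if_splits)
  define v where "v = V *\<^sub>v y"
  have v: "v \<in> carrier_vec N" unfolding v_def by (rule mult_mat_vec_carrier[OF V(1) y(1)])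
  have Vv: "mat_adjoint V *\<^sub>v v = y"
    unfolding v_def by (rule unitary_cancel(3)[OF diagonalizesD(1)[OF B] y(1)])
  have Uv: "mat_adjoint U *\<^sub>v v = X *\<^sub>v y"
    unfolding v_def X_def using assoc_mult_mat_vec[OF U(2) V(1) y(1)] by simp
  have x0: "(X *\<^sub>v y) $ i = 0" if "i < m - 1" for i
    using Ry[of i] that X m unfolding R_def by auto
  have "W *\<^sub>v v = Y *\<^sub>v y"
    unfolding v_def Y_def using assoc_mult_mat_vec[OF W V(1) y(1)] by simp
  also have "\<dots> = 0\<^sub>v c"
  proof (rule eq_vecI)
    fix j assume "j < dim_vec (0\<^sub>v c :: complex vec)"
    then have j: "j < c" by simp
    then show "(Y *\<^sub>v y) $ j = 0\<^sub>v c $ j"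
    proof -
      have "\<not> m - 1 + j < m - 1" "m - 1 + j < m + c - 1" "m - 1 + j - (m - 1) = j" "m - 1 + j < N"
        using j m by auto
      then have "row Y j \<bullet> y = 0" using Ry[of "m - 1 + j"] unfolding R_def by simp
      then show ?thesis using j Y by simp
    qed
  qed (use Y in auto)
  finally have Wv: "W *\<^sub>v v = 0\<^sub>v c" .
  have "b (m + c) * vec_norm_sq y = (\<Sum>i<N. b (m + c) * (cmod (y $ i))\<^sup>2)"
    using y(1) by (simp add: vec_norm_sq_def sum_distrib_left)
  also have "\<dots> \<le> (\<Sum>i<N. b (Suc i) * (cmod (y $ i))\<^sup>2)"
  proof (rule sum_mono)
    fix i assume "i \<in> {..<N}"
    then show "b (m + c) * (cmod (y $ i))\<^sup>2 \<le> b (Suc i) * (cmod (y $ i))\<^sup>2"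
    proof (cases "i < m + c")
      case True
      then have "b (m + c) \<le> b (Suc i)" using monotone_onD[OF b, of "Suc i" "m + c"] m by auto
      then show ?thesis by (intro mult_right_mono) auto
    qed (use y0 in auto)
  qed
  also have "\<dots> = Re ((B *\<^sub>v v) \<bullet>c v)" unfolding quadratic_form[OF B v] Vv by simp
  also have "\<dots> \<le> Re ((A *\<^sub>v v) \<bullet>c v)" by (rule le[OF v Wv])
  also have "\<dots> = (\<Sum>i<N. a (Suc i) * (cmod ((X *\<^sub>v y) $ i))\<^sup>2)"
    unfolding quadratic_form[OF A v] Uv by simp
  also have "\<dots> \<le> (\<Sum>i<N. a m * (cmod ((X *\<^sub>v y) $ i))\<^sup>2)"
  proof (rule sum_mono)
    fix i assume i: "i \<in> {..<N}"
    show "a (Suc i) * (cmod ((X *\<^sub>v y) $ i))\<^sup>2 \<le> a m * (cmod ((X *\<^sub>v y) $ i))\<^sup>2"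
    proof (cases "i < m - 1")
      case False
      then have "a (Suc i) \<le> a m" using monotone_onD[OF a, of m "Suc i"] m i by auto
      then show ?thesis by (intro mult_right_mono) auto
    qed (use x0 in auto)
  qed
  also have "\<dots> = a m * vec_norm_sq (X *\<^sub>v y)"
    using X by (simp add: vec_norm_sq_def sum_distrib_left)
  also have "vec_norm_sq (X *\<^sub>v y) = vec_norm_sq v"
    unfolding Uv[symmetric] by (rule unitary_norm[OF unitary_adjoint[OF diagonalizesD(1)[OF A]] v])
  also have "\<dots> = vec_norm_sq y"
    unfolding v_def by (rule unitary_norm[OF diagonalizesD(1)[OF B] y(1)])
  finally show ?thesis using vec_norm_sq_pos[OF y(1,2)] by simp
qed

lemma outer_mult_vec:
  assumes "f \<in> carrier_vec N" "v \<in> carrier_vec N"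
  shows "outer f *\<^sub>v v = (v \<bullet>c f) \<cdot>\<^sub>v f"
  using assms
  by (intro eq_vecI) (auto simp: outer_def scalar_prod_def sum_distrib_left sum_distrib_right mult_ac intro!: sum.cong)

lemma quadratic_form_add_outer:
  assumes A: "A \<in> carrier_mat N N" and f: "f \<in> carrier_vec N" and v: "v \<in> carrier_vec N"
  shows "((A + outer f) *\<^sub>v v) \<bullet>c v = (A *\<^sub>v v) \<bullet>c v + complex_of_real ((cmod (v \<bullet>c f))\<^sup>2)"
proof -
  have vc: "conjugate v \<in> carrier_vec N" using v by simp
  have Av: "A *\<^sub>v v \<in> carrier_vec N" using A v by simp
  have ff: "(v \<bullet>c f) \<cdot>\<^sub>v f \<in> carrier_vec N" using f by simp
  have "(A + outer f) *\<^sub>v v = A *\<^sub>v v + (v \<bullet>c f) \<cdot>\<^sub>v f"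
    using add_mult_distrib_mat_vec[OF A outer_carrier[OF f] v] outer_mult_vec[OF f v] by simp
  also have "\<dots> \<bullet>c v = (A *\<^sub>v v) \<bullet>c v + (v \<bullet>c f) * (f \<bullet>c v)"
    using add_scalar_prod_distrib[OF Av ff vc] smult_scalar_prod_distrib[OF f vc] by simp
  also have "f \<bullet>c v = cnj (v \<bullet>c f)"
    using f v by (auto simp: scalar_prod_def mult_ac intro!: sum.cong)
  finally show ?thesis by (simp only: complex_norm_square)
qed

text \<open>
  The quadratic form grows by \<open>\<bar>\<langle>v, f\<rangle>\<bar>\<^sup>2\<close>, which is nonnegative and vanishes on the hyperplane
  orthogonal to \<open>f\<close>.  The two comparisons use no linear condition and this single one.
\<close>
theorem rank_one_update_interlacing:
  assumes A: "A \<in> carrier_mat N N" "self_adjoint A" "has_spectrum N A a"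
    and f: "f \<in> carrier_vec N" and B: "self_adjoint (A + outer f)" "has_spectrum N (A + outer f) b"
    and a: "antimono_on {1..N} a" and b: "antimono_on {1..N} b"
  shows "m \<in> {1..N} \<Longrightarrow> a m \<le> b m" and "1 \<le> m \<Longrightarrow> m + 1 \<le> N \<Longrightarrow> b (m + 1) \<le> a m"
proof -
  have Bc: "A + outer f \<in> carrier_mat N N" using f by simp
  obtain U where U: "diagonalizes N U a A" using spectral_theorem[OF A] by auto
  obtain V where V: "diagonalizes N V b (A + outer f)" using spectral_theorem[OF Bc B] by auto
  have "a (m + 0) \<le> b m" if "m \<in> {1..N}"
    by (rule eigenvalue_comparison[OF V U b a, of "0\<^sub>m 0 N"])
       (use that in \<open>auto simp: quadratic_form_add_outer[OF A(1) f]\<close>)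
  then show "m \<in> {1..N} \<Longrightarrow> a m \<le> b m" by simp
  have cf: "conjugate f \<in> carrier_vec N" using f by simp
  show "b (m + 1) \<le> a m" if "1 \<le> m" "m + 1 \<le> N"
  proof (rule eigenvalue_comparison[OF U V a b, of "mat_of_rows N [conjugate f]"])
    fix v :: "complex vec" assume v: "v \<in> carrier_vec N" "mat_of_rows N [conjugate f] *\<^sub>v v = 0\<^sub>v 1"
    have "conjugate f \<bullet> v = 0"
      using arg_cong[OF v(2), of "\<lambda>v. v $ 0"] cf by (simp add: mat_of_rows_row)
    then have "v \<bullet>c f = 0" using comm_scalar_prod[OF cf v(1)] by simp
    then show "Re (((A + outer f) *\<^sub>v v) \<bullet>c v) \<le> Re ((A *\<^sub>v v) \<bullet>c v)"
      unfolding quadratic_form_add_outer[OF A(1) f v(1)] by simp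
  qed (use that in auto)
qed

text \<open>
  Comparison of traces, since \<open>f f\<^sup>*\<close> has trace \<open>\<parallel>f\<parallel>\<^sup>2\<close>.
\<close>
lemma rank_one_update_sum_spectrum:
  assumes A: "A \<in> carrier_mat N N" "self_adjoint A" "has_spectrum N A a"
    and f: "f \<in> carrier_vec N" and B: "self_adjoint (A + outer f)" "has_spectrum N (A + outer f) b"
  shows "(\<Sum>m=1..N. b m) = (\<Sum>m=1..N. a m) + vec_norm_sq f"
proof -
  have Bc: "A + outer f \<in> carrier_mat N N" using f by simp
  obtain U where U: "diagonalizes N U a A" using spectral_theorem[OF A] by auto
  obtain V where V: "diagonalizes N V b (A + outer f)" using spectral_theorem[OF Bc B] by auto
  have "complex_of_real (\<Sum>m=1..N. b m) = (\<Sum>i<N. (A + outer f) $$ (i, i))"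
    by (rule sum_spectrum_eq_sum_diagonal[OF V, symmetric])
  also have "\<dots> = (\<Sum>i<N. A $$ (i, i)) + (\<Sum>i<N. f $ i * cnj (f $ i))"
    using f A(1) by (simp add: outer_def sum.distrib)
  also have "(\<Sum>i<N. f $ i * cnj (f $ i)) = complex_of_real (vec_norm_sq f)"
    using f by (simp only: complex_norm_square[symmetric] vec_norm_sq_def carrier_vecD of_real_sum)
  also have "(\<Sum>i<N. A $$ (i, i)) = complex_of_real (\<Sum>m=1..N. a m)"
    by (rule sum_spectrum_eq_sum_diagonal[OF U])
  finally show ?thesis by (simp only: of_real_add[symmetric] of_real_eq_iff)
qed

section \<open>Frame operators\<close>

lemma synthesis_carrier [simp]: "synthesis N f n \<in> carrier_mat N n"
  using mat_of_cols_carrier(1)[of N "map f [1..<Suc n]"] unfolding synthesis_def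
  by (simp del: upt_Suc)

lemma synthesis_index:
  "i < N \<Longrightarrow> j < n \<Longrightarrow> synthesis N f n $$ (i, j) = f (Suc j) $ i"
  unfolding synthesis_def by (subst mat_of_cols_index) (auto simp del: upt_Suc)

lemma frame_operator_carrier [simp]: "frame_operator N f n \<in> carrier_mat N N"
  unfolding frame_operator_def
  by (rule mult_carrier_mat[OF synthesis_carrier mat_adjoint_carrier[OF synthesis_carrier]])

lemma self_adjoint_frame_operator: "self_adjoint (frame_operator N f n)"
  unfolding self_adjoint_def frame_operator_def
  using mat_adjoint_mult[OF synthesis_carrier[of N f n] mat_adjoint_carrier[OF synthesis_carrier[of N f n]]]
  by simp

lemma frame_operator_index:
  assumes "i < N" "j < N"
  shows "frame_operator N f n $$ (i, j) = (\<Sum>k<n. f (Suc k) $ i * cnj (f (Suc k) $ j))"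
  using assms carrier_matD[OF synthesis_carrier[of N f n]]
  by (auto simp: frame_operator_def scalar_prod_def lessThan_atLeast0 synthesis_index intro!: sum.cong)

lemma frame_operator_0: "frame_operator N f 0 = 0\<^sub>m N N"
  by (rule eq_matI) (auto simp: frame_operator_index carrier_matD[OF frame_operator_carrier])

lemma frame_operator_Suc:
  assumes "f (Suc n) \<in> carrier_vec N"
  shows "frame_operator N f (Suc n) = frame_operator N f n + outer (f (Suc n))"
  using assms
  by (intro eq_matI)
     (auto simp: frame_operator_index carrier_matD[OF frame_operator_carrier] outer_def)

lemma gram_matrix_diagonal:
  assumes "n \<in> {1..M}" "f n \<in> carrier_vec N"
  shows "(mat_adjoint (synthesis N f M) * synthesis N f M) $$ (n - 1, n - 1) =
    complex_of_real (vec_norm_sq (f n))"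
proof -
  have "(mat_adjoint (synthesis N f M) * synthesis N f M) $$ (n - 1, n - 1) =
      (\<Sum>i<N. f n $ i * cnj (f n $ i))"
    using assms carrier_matD[OF synthesis_carrier[of N f M]]
    by (auto simp: scalar_prod_def lessThan_atLeast0 synthesis_index mult_ac intro!: sum.cong)
  also have "\<dots> = complex_of_real (vec_norm_sq (f n))"
    using assms by (simp only: complex_norm_square[symmetric] vec_norm_sq_def carrier_vecD of_real_sum)
  finally show ?thesis .
qed

lemma synthesis_of_columns:
  assumes F: "F \<in> carrier_mat N n"
  shows "synthesis N (\<lambda>k. col F (k - 1)) n = F"
  using assms carrier_matD[OF synthesis_carrier[of N "\<lambda>k. col F (k - 1)" n]]
  by (intro eq_matI) (auto simp: synthesis_index)

lemma diagonalizes_zero: "diagonalizes N (1\<^sub>m N) (\<lambda>_. 0) (0\<^sub>m N N)"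
  unfolding diagonalizes_def using unitary_one[of N]
  by (auto intro!: eq_matI simp: mat_diag_def)

lemma has_spectrum_add_scalar:
  assumes A: "A \<in> carrier_mat N N" "self_adjoint A" "has_spectrum N A a"
  shows "has_spectrum N (A + complex_of_real c \<cdot>\<^sub>m 1\<^sub>m N) (\<lambda>n. a n + c)"
proof -
  obtain U where U: "diagonalizes N U a A" using spectral_theorem[OF A] by auto
  note Uc = unitaryD[OF diagonalizesD(1)[OF U]]
  let ?D = "mat_diag N (\<lambda>i. complex_of_real (a (Suc i)))"
  have D: "?D \<in> carrier_mat N N" and c: "complex_of_real c \<cdot>\<^sub>m 1\<^sub>m N \<in> carrier_mat N N" by auto
  have split: "mat_diag N (\<lambda>i. complex_of_real (a (Suc i) + c)) = ?D + complex_of_real c \<cdot>\<^sub>m 1\<^sub>m N"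
    by (rule eq_matI) (auto simp: mat_diag_def)
  have "diagonalizes N U (\<lambda>n. a n + c) (A + complex_of_real c \<cdot>\<^sub>m 1\<^sub>m N)"
    unfolding diagonalizes_def split mult_add_distrib_mat[OF Uc(1) D c]
      add_mult_distrib_mat[OF mult_carrier_mat[OF Uc(1) D] mult_carrier_mat[OF Uc(1) c] Uc(2)]
    using diagonalizesD(1,2)[OF U] unitary_conj_scalar[OF diagonalizesD(1)[OF U]] by simp
  then show ?thesis by (rule diagonalizes_has_spectrum)
qed

lemma has_spectrum_mset_cong:
  assumes "image_mset a (mset_set {1..N}) = image_mset b (mset_set {1..N})" "has_spectrum N A a"
  shows "has_spectrum N A b"
proof -
  have "image_mset complex_of_real (image_mset a (mset_set {1..N})) =
    image_mset complex_of_real (image_mset b (mset_set {1..N}))" using assms(1) by simp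
  then show ?thesis
    using assms(2) unfolding has_spectrum_def by (simp add: image_mset.compositionality o_def)
qed

section \<open>Every outcome of the process is correct\<close>

lemma step_A_entry:
  assumes "step_A N lam mu L" "1 \<le> n" "n < N" "k \<in> {1..N}"
  shows "if k > n then L n k = 0
    else L n k \<in> {lower_end N mu L (Suc n) k .. upper_end N mu L (Suc n) k}"
proof -
  have *: "\<forall>n\<in>{2..N}. \<forall>k\<in>{1..N}. if k > n - 1 then L (n - 1) k = 0
      else L (n - 1) k \<in> {lower_end N mu L n k .. upper_end N mu L n k}"
    using assms(1) unfolding step_A_def by blast
  show ?thesis using bspec[OF bspec[OF *], of "Suc n" k] assms(2-) unfolding diff_Suc_1 by auto
qed

text \<open>
  For \<open>k = 1\<close>, the second term of the lower end and the term \<open>l = 1\<close> of the upper end bound the row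
  sum of \<open>L n\<close> from below by that of \<open>L (n + 1)\<close> minus \<open>mu (n + 1)\<close>, and from above by
  \<open>mu 1 + \<dots> + mu n\<close>.  Going down from \<open>n = N\<close>, these two bounds coincide.
\<close>
lemma step_A_partial_sums:
  assumes L: "step_A N lam mu L" and tr: "(\<Sum>m=1..N. lam m) = (\<Sum>m=1..N. mu m)"
    and n: "1 \<le> n" "n \<le> N"
  shows "(\<Sum>m=1..N. L n m) = (\<Sum>m=1..n. mu m)"
  using n(2) n(1)
proof (induction n rule: inc_induct)
  case base
  have "(\<Sum>m=1..N. L N m) = (\<Sum>m=1..N. lam m)"
    using L unfolding step_A_def by (intro sum.cong) auto
  then show ?case using tr by simp
next
  case (step n)
  then have IH: "(\<Sum>m=1..N. L (Suc n) m) = (\<Sum>m=1..Suc n. mu m)" by simp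
  have mem: "L n 1 \<in> {lower_end N mu L (Suc n) 1 .. upper_end N mu L (Suc n) 1}"
    using step_A_entry[OF L, of n 1] step.hyps step.prems by simp
  have split: "(\<Sum>m=1..N. L n m) = L n 1 + (\<Sum>m=2..N. L n m)"
    using step.hyps step.prems by (subst sum.atLeast_Suc_atMost) (auto simp: numeral_2_eq_2)
  have "(\<Sum>m=1..N. L (Suc n) m) - (\<Sum>m=2..N. L n m) - mu (Suc n) \<le> lower_end N mu L (Suc n) 1"
    unfolding lower_end_def by (simp add: numeral_2_eq_2)
  moreover have "upper_end N mu L (Suc n) 1 \<le> (\<Sum>m=1..n. mu m) - (\<Sum>m=2..N. L n m)"
    unfolding upper_end_def by (simp add: numeral_2_eq_2)
  ultimately show ?case using mem IH split by simp
qed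

text \<open>
  The outer product is a rank-one update of the zero matrix, and for \<open>A = 0\<close> the secular equation
  reads \<open>1 - \<parallel>f\<parallel>\<^sup>2 / x\<close>, which is also the quotient obtained from the claimed spectrum.
\<close>
lemma outer_spectrum:
  assumes N: "N \<ge> 1" and f: "f \<in> carrier_vec N"
  shows "has_spectrum N (outer f) (\<lambda>m. if m = 1 then vec_norm_sq f else 0)"
proof -
  let ?z = "\<lambda>_::nat. 0 :: real" and ?c = "\<lambda>m::nat. if m = 1 then vec_norm_sq f else 0"
  note z = diagonalizes_zero[of N]
  have outer: "outer f = 0\<^sub>m N N + outer f" using outer_carrier[OF f] by simp
  have "self_adjoint (outer f)"
    unfolding self_adjoint_def by (rule eq_matI) (auto simp: outer_def)
  then obtain b where b: "has_spectrum N (outer f) b"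
    using self_adjoint_sorted_spectrum[OF outer_carrier[OF f]] by blast
  have prods: "(\<Prod>m=1..N. x - b m) = (\<Prod>m=1..N. x - ?c m)" if "x \<noteq> 0" for x
  proof -
    have "(\<Prod>m=1..N. x - b m) / (\<Prod>m=1..N. x - ?z m) = 1 - vec_norm_sq f / x"
      using rank_one_update_ratio[OF z f, of b x] b that f outer
      by (simp add: vec_norm_sq_def flip: sum_divide_distrib)
    moreover have "(\<Prod>m=1..N. x - ?c m) = (x - vec_norm_sq f) * x ^ (N - 1)"
    proof -
      have "(\<Prod>m=1..N. x - ?c m) = (x - ?c 1) * (\<Prod>m=2..N. x - ?c m)"
        using N by (subst prod.atLeast_Suc_atMost) (auto simp: numeral_2_eq_2)
      also have "(\<Prod>m=2..N. x - ?c m) = (\<Prod>m=2..N. x)" by (intro prod.cong) auto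
      finally show ?thesis by simp
    qed
    moreover have "(\<Prod>m=1..N. x - ?z m) = x * x ^ (N - 1)"
      using N by (simp flip: power_Suc)
    moreover have "u = (x - s) * v" if "u / (x * v) = 1 - s / x" "x \<noteq> 0" "v \<noteq> 0" for u v s :: real
      using that by (simp add: field_simps)
    ultimately show ?thesis using that by simp
  qed
  have "image_mset b (mset_set {1..N}) = image_mset ?c (mset_set {1..N})"
  proof (rule spectrum_determined_by_residues)
    fix t :: real assume "t \<in> ?z ` {1..N}"
    then have t: "t = 0" by auto
    let ?r = "- vec_norm_sq (orth_proj (mat_kernel (complex_of_real t \<cdot>\<^sub>m 1\<^sub>m N - 0\<^sub>m N N)) f)"
    show *: "((\<lambda>x. (x - t) * ((\<Prod>m=1..N. x - b m) / (\<Prod>m=1..N. x - ?z m))) \<longlongrightarrow> ?r) (at t)"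
      using rank_one_update_residue[OF diagonalizesD(3)[OF z] diagonalizes_self_adjoint[OF z]
        diagonalizes_has_spectrum[OF z] f, of b t] b outer by simp
    show "((\<lambda>x. (x - t) * ((\<Prod>m=1..N. x - ?c m) / (\<Prod>m=1..N. x - ?z m))) \<longlongrightarrow> ?r) (at t)"
    proof (rule Lim_transform_eventually[OF *])
      show "eventually (\<lambda>x. (x - t) * ((\<Prod>m=1..N. x - b m) / (\<Prod>m=1..N. x - ?z m)) =
          (x - t) * ((\<Prod>m=1..N. x - ?c m) / (\<Prod>m=1..N. x - ?z m))) (at t)"
        unfolding eventually_at_filter t by (intro always_eventually allI impI) (simp only: prods not_False_eq_True)
    qed
  qed
  then show ?thesis using has_spectrum_mset_cong b by blast
qed

lemma step_B_limit:
  assumes "step_B N mu L f" "n \<in> {1..N - 1}" "t \<in> L n ` {1..N}"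
  shows "((\<lambda>x. (x - t) * ((\<Prod>m=1..N. x - L (n + 1) m) / (\<Prod>m=1..N. x - L n m))) \<longlongrightarrow>
    - vec_norm_sq (orth_proj
        (mat_kernel (complex_of_real t \<cdot>\<^sub>m 1\<^sub>m N - frame_operator N f n)) (f (n + 1)))) (at t)"
  using assms unfolding step_B_def spec_poly_def by blast

text \<open>
  Step B prescribes for row \<open>n + 1\<close> exactly the limits that the true spectrum of the next frame
  operator has, and these limits determine the spectrum.  Step A enters through \<open>L 1\<close> only, which
  it forces to be \<open>mu 1, 0, \<dots>, 0\<close>, the spectrum of the first frame operator.
\<close>
theorem frame_operator_spectrum:
  assumes A: "step_A N lam mu L" and B: "step_B N mu L f"
    and tr: "(\<Sum>m=1..N. lam m) = (\<Sum>m=1..N. mu m)" and n: "1 \<le> n" "n \<le> N"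
  shows "has_spectrum N (frame_operator N f n) (L n)"
  using n
proof (induction n rule: dec_induct)
  case base
  then have f: "f 1 \<in> carrier_vec N" and f1: "vec_norm_sq (f 1) = mu 1"
    using B unfolding step_B_def by auto
  have L1: "L 1 k = (if k = 1 then vec_norm_sq (f 1) else 0)" if "k \<in> {1..N}" for k
  proof -
    have 0: "L 1 k = 0" if "k \<in> {2..N}" for k
      using step_A_entry[OF A, of 1 k] that by simp
    have "(\<Sum>m=1..N. L 1 m) = mu 1" using step_A_partial_sums[OF A tr, of 1] base by simp
    moreover have "(\<Sum>m=1..N. L 1 m) = L 1 1 + (\<Sum>m=2..N. L 1 m)"
      using base by (subst sum.atLeast_Suc_atMost) (auto simp: numeral_2_eq_2)
    moreover have "(\<Sum>m=2..N. L 1 m) = 0" using 0 by (intro sum.neutral) auto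
    ultimately show ?thesis using 0 that f1 by auto
  qed
  have "frame_operator N f 1 = outer (f 1)"
    using frame_operator_Suc[of f 0 N] f outer_carrier[OF f] by (simp add: frame_operator_0)
  moreover have "image_mset (\<lambda>m. if m = 1 then vec_norm_sq (f 1) else 0) (mset_set {1..N}) =
      image_mset (L 1) (mset_set {1..N})"
    using L1 by (intro image_mset_cong) auto
  ultimately show ?case using has_spectrum_mset_cong outer_spectrum[OF _ f] base by metis
next
  case (step n)
  then have IH: "has_spectrum N (frame_operator N f n) (L n)" by simp
  have f: "f (Suc n) \<in> carrier_vec N" using B step.hyps step.prems unfolding step_B_def by auto
  obtain b where b: "has_spectrum N (frame_operator N f (Suc n)) b"
    using self_adjoint_sorted_spectrum[OF frame_operator_carrier self_adjoint_frame_operator] by blast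
  have "image_mset b (mset_set {1..N}) = image_mset (L (Suc n)) (mset_set {1..N})"
  proof (rule spectrum_determined_by_residues)
    fix t assume t: "t \<in> L n ` {1..N}"
    let ?r = "- vec_norm_sq (orth_proj (mat_kernel
      (complex_of_real t \<cdot>\<^sub>m 1\<^sub>m N - frame_operator N f n)) (f (Suc n)))"
    show "((\<lambda>x. (x - t) * ((\<Prod>m=1..N. x - b m) / (\<Prod>m=1..N. x - L n m))) \<longlongrightarrow> ?r) (at t)"
      using rank_one_update_residue[OF frame_operator_carrier self_adjoint_frame_operator IH f] b
      unfolding frame_operator_Suc[of f n N, OF f] by blast
    have "n \<in> {1..N - 1}" using step.hyps step.prems by auto
    from step_B_limit[OF B this t]
    show "((\<lambda>x. (x - t) * ((\<Prod>m=1..N. x - L (Suc n) m) / (\<Prod>m=1..N. x - L n m))) \<longlongrightarrow> ?r) (at t)"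
      by (simp only: Suc_eq_plus1)
  qed
  then show ?case using has_spectrum_mset_cong b by blast
qed

text \<open>
  The norm of the new vector is the increase of the trace of the frame operator.
\<close>
lemma norm_sq_frame_vector:
  assumes A: "step_A N lam mu L" and B: "step_B N mu L f"
    and tr: "(\<Sum>m=1..N. lam m) = (\<Sum>m=1..N. mu m)" and n: "n \<in> {1..N}"
  shows "vec_norm_sq (f n) = mu n"
proof (cases "n = 1")
  case True
  then show ?thesis using B unfolding step_B_def by simp
next
  case False
  then obtain k where k: "n = Suc k" "1 \<le> k" "k \<le> N" using n by (cases n) auto
  have f: "f (Suc k) \<in> carrier_vec N" using B n k unfolding step_B_def by auto
  note fo = frame_operator_Suc[of f k N, OF f]
  have "(\<Sum>m=1..N. L (Suc k) m) = (\<Sum>m=1..N. L k m) + vec_norm_sq (f (Suc k))"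
    using rank_one_update_sum_spectrum[OF frame_operator_carrier self_adjoint_frame_operator
      frame_operator_spectrum[OF A B tr k(2,3)] f, of "L (Suc k)"]
      self_adjoint_frame_operator[of N f "Suc k"] frame_operator_spectrum[OF A B tr, of "Suc k"] n k
    unfolding fo by simp
  moreover have "(\<Sum>m=1..N. L (Suc k) m) = (\<Sum>m=1..Suc k. mu m)"
    by (rule step_A_partial_sums[OF A tr]) (use n k in auto)
  moreover have "(\<Sum>m=1..N. L k m) = (\<Sum>m=1..k. mu m)"
    by (rule step_A_partial_sums[OF A tr]) (use n k in auto)
  ultimately show ?thesis using k by simp
qed

text \<open>
  The process controls the frame operator \<open>F F\<^sup>*\<close>; its spectrum passes to the Gram matrix \<open>F\<^sup>* F\<close>
  because the two products of square matrices have the same characteristic polynomial.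
\<close>
theorem frame_construction_sound:
  assumes N: "N \<ge> 1" and F: "frame_construction N lam mu F"
    and tr: "(\<Sum>m=1..N. lam m) = (\<Sum>m=1..N. mu m)"
  shows "F \<in> carrier_mat N N" "has_spectrum N (mat_adjoint F * F) lam" "has_diagonal N (mat_adjoint F * F) mu"
proof -
  obtain L f where A: "step_A N lam mu L" and B: "step_B N mu L f" and Ff: "F = synthesis N f N"
    using F unfolding frame_construction_def by auto
  show Fc: "F \<in> carrier_mat N N" unfolding Ff by simp
  have "has_spectrum N (F * mat_adjoint F) (L N)"
    using frame_operator_spectrum[OF A B tr N] unfolding frame_operator_def Ff by simp
  then have "has_spectrum N (mat_adjoint F * F) (L N)"
    unfolding has_spectrum_def using char_poly_mult_commute[OF Fc mat_adjoint_carrier[OF Fc]] by simp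
  moreover have "image_mset (L N) (mset_set {1..N}) = image_mset lam (mset_set {1..N})"
    using A unfolding step_A_def by (intro image_mset_cong) auto
  ultimately show "has_spectrum N (mat_adjoint F * F) lam" using has_spectrum_mset_cong by blast
  show "has_diagonal N (mat_adjoint F * F) mu"
    unfolding has_diagonal_def
  proof
    fix n assume n: "n \<in> {1..N}"
    then have fn: "f n \<in> carrier_vec N" using B unfolding step_B_def by blast
    show "(mat_adjoint F * F) $$ (n - 1, n - 1) = complex_of_real (mu n)"
      unfolding Ff gram_matrix_diagonal[of n N f N, OF n fn] norm_sq_frame_vector[OF A B tr n]
      by (rule refl)
  qed
qed

section \<open>Every matrix is an outcome of the process\<close>

text \<open>
  The data that a given positive semidefinite matrix provides: the columns of a factor and the
  sorted spectra of their frame operators.  The index \<open>n = 0\<close>, where the frame operator is \<open>0\<close>, is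
  included as the start of the inductions.
\<close>
locale frame_spectra =
  fixes N :: nat and mu :: "nat \<Rightarrow> real" and f :: "nat \<Rightarrow> complex vec" and L :: "nat \<Rightarrow> nat \<Rightarrow> real"
  assumes f: "n \<in> {1..N} \<Longrightarrow> f n \<in> carrier_vec N"
    and norm: "n \<in> {1..N} \<Longrightarrow> vec_norm_sq (f n) = mu n"
    and sorted: "antimono_on {1..N} (L n)"
    and spectrum: "has_spectrum N (frame_operator N f n) (L n)"
begin

lemma spectrum_Suc:
  assumes "n < N"
  shows "has_spectrum N (frame_operator N f n + outer (f (Suc n))) (L (Suc n))"
    "self_adjoint (frame_operator N f n + outer (f (Suc n)))"
    "f (Suc n) \<in> carrier_vec N"
proof -
  show fn: "f (Suc n) \<in> carrier_vec N" using f assms by simp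
  show "has_spectrum N (frame_operator N f n + outer (f (Suc n))) (L (Suc n))"
    "self_adjoint (frame_operator N f n + outer (f (Suc n)))"
    using spectrum[of "Suc n"] self_adjoint_frame_operator[of N f "Suc n"]
    unfolding frame_operator_Suc[of f n N, OF fn] by auto
qed

lemma interlacing:
  assumes n: "n < N"
  shows "m \<in> {1..N} \<Longrightarrow> L n m \<le> L (Suc n) m"
    and "1 \<le> m \<Longrightarrow> m + 1 \<le> N \<Longrightarrow> L (Suc n) (m + 1) \<le> L n m"
  using rank_one_update_interlacing[OF frame_operator_carrier self_adjoint_frame_operator spectrum
      spectrum_Suc(3)[OF n] spectrum_Suc(2)[OF n] spectrum_Suc(1)[OF n] sorted sorted]
  by blast+

lemma mono_in_n:
  assumes "m \<in> {1..N}" "j \<le> n" "n \<le> N"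
  shows "L j m \<le> L n m"
  using assms(2,3)
proof (induction n rule: dec_induct)
  case (step n)
  from interlacing(1)[of n m] step assms(1) show ?case by simp
qed simp

lemma spectrum_0: "m \<in> {1..N} \<Longrightarrow> L 0 m = 0"
proof -
  assume m: "m \<in> {1..N}"
  have "has_spectrum N (0\<^sub>m N N) (L 0)" using spectrum[of 0] by (simp add: frame_operator_0)
  then have "image_mset (\<lambda>n. complex_of_real (L 0 n)) (mset_set {1..N}) =
      image_mset (\<lambda>n. complex_of_real 0) (mset_set {1..N})"
    using diagonalizes_has_spectrum[OF diagonalizes_zero[of N]] unfolding has_spectrum_def by simp
  from arg_cong[OF this, of set_mset] show ?thesis using m by auto
qed

text \<open>
  The rank bound on the frame operator of \<open>n\<close> vectors, obtained from interlacing alone: the entry is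
  at most its diagonal predecessor, which is \<open>0\<close>, and at least the corresponding eigenvalue of the
  zero matrix.
\<close>
lemma spectrum_beyond: "n \<le> N \<Longrightarrow> n < m \<Longrightarrow> m \<le> N \<Longrightarrow> L n m = 0"
proof (induction n arbitrary: m)
  case 0
  then show ?case by (intro spectrum_0) auto
next
  case (Suc n)
  then obtain k where k: "m = k + 1" "n < k" by (cases m) auto
  have "L (Suc n) m \<le> L n k" unfolding k by (rule interlacing(2)) (use Suc k in auto)
  moreover have "L n k = 0" using Suc k by simp
  moreover have "L 0 m \<le> L (Suc n) m" by (rule mono_in_n) (use Suc in auto)
  moreover have "L 0 m = 0" by (rule spectrum_0) (use Suc in auto)
  ultimately show ?case by simp
qed

lemma sum_spectrum: "n \<le> N \<Longrightarrow> (\<Sum>m=1..N. L n m) = (\<Sum>m=1..n. mu m)"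
proof (induction n)
  case 0
  then show ?case using spectrum_0 by simp
next
  case (Suc n)
  then have "n < N" by simp
  note S = spectrum_Suc[OF this]
  have "(\<Sum>m=1..N. L (Suc n) m) = (\<Sum>m=1..N. L n m) + vec_norm_sq (f (Suc n))"
    by (rule rank_one_update_sum_spectrum[OF frame_operator_carrier self_adjoint_frame_operator
          spectrum S(3,2,1)])
  then show ?case using Suc norm[of "Suc n"] by simp
qed

lemma sum_spectrum_upto: "n \<le> N \<Longrightarrow> (\<Sum>m=1..n. L n m) = (\<Sum>m=1..n. mu m)"
proof -
  assume n: "n \<le> N"
  have "(\<Sum>m=1..n. L n m) = (\<Sum>m=1..N. L n m)"
    by (rule sum.mono_neutral_left) (use n spectrum_beyond in auto)
  then show ?thesis using sum_spectrum[OF n] by simp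
qed

text \<open>
  Schur's inequality for the Gram matrix of \<open>f 1, \<dots>, f n\<close>.  For the leading parts, \<open>mu 1, \<dots>, mu (l - 1)\<close>
  add up to the sum of the first \<open>l - 1\<close> eigenvalues of the frame operator of \<open>l - 1\<close> vectors, and
  each of these eigenvalues is at most its counterpart for \<open>n\<close> vectors.
\<close>
lemma tail_sum_le:
  assumes l: "1 \<le> l" "l \<le> Suc n" and n: "n \<le> N"
  shows "(\<Sum>m=l..N. L n m) \<le> (\<Sum>m=l..n. mu m)"
proof -
  have split: "(\<Sum>m=1..k. g m) = (\<Sum>m=1..l-1. g m) + (\<Sum>m=l..k. g m)" if "l \<le> Suc k" for k
    and g :: "nat \<Rightarrow> real"
    using sum.ub_add_nat[of 1 "l - 1" g "k - (l - 1)"] l that by simp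
  have "(\<Sum>m=1..l-1. mu m) = (\<Sum>m=1..l-1. L (l - 1) m)"
    using sum_spectrum_upto[of "l - 1"] l n by simp
  also have "\<dots> \<le> (\<Sum>m=1..l-1. L n m)"
    by (intro sum_mono mono_in_n) (use l n in auto)
  finally show ?thesis
    using split[of N "L n"] split[of n mu] sum_spectrum[OF n] l n by simp
qed

text \<open>
  The lower bounds are interlacing and the fact that the nonnegative increments \<open>L (j + 1) m - L j m\<close>
  sum to \<open>mu (j + 1)\<close>.  For the upper bounds with a partial sum of \<open>mu\<close>, interlacing replaces each \<open>L (j + 1) (m + 1)\<close> by
  \<open>L j m\<close>, which leaves a tail sum of \<open>L j\<close>, and Schur's inequality applies.
\<close>
theorem spectra_satisfy_step_A: "step_A N (L N) mu L"
  unfolding step_A_def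
proof (intro conjI ballI)
  fix n k assume n: "n \<in> {2..N}" and k: "k \<in> {1..N}"
  define j where "j = n - 1"
  have j: "n = Suc j" "1 \<le> j" "j < N" using n unfolding j_def by auto
  show "if k > n - 1 then L (n - 1) k = 0
    else L (n - 1) k \<in> {lower_end N mu L n k .. upper_end N mu L n k}"
  proof (cases "k > n - 1")
    case True
    then show ?thesis using spectrum_beyond[of j k] j k by simp
  next
    case False
    then have kj: "1 \<le> k" "k \<le> j" using k j by auto
    have head: "(\<Sum>m=k..N. L j m) = L j k + (\<Sum>m=k+1..N. L j m)"
      using kj j by (subst sum.atLeast_Suc_atMost) auto
    have inc: "(\<Sum>m=k..N. L (Suc j) m) - (\<Sum>m=k..N. L j m) \<le> mu (Suc j)"
    proof -
      have "(\<Sum>m=k..N. L (Suc j) m - L j m) \<le> (\<Sum>m=1..N. L (Suc j) m - L j m)"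
        by (rule sum_mono2) (use kj j interlacing(1) in auto)
      also have "\<dots> = mu (Suc j)"
        using sum_spectrum[of "Suc j"] sum_spectrum[of j] j by (simp add: sum_subtractf)
      finally show ?thesis by (simp add: sum_subtractf)
    qed
    have "lower_end N mu L (Suc j) k \<le> L j k"
      unfolding lower_end_def using inc head interlacing(2)[of j k] kj j by auto
    moreover have "L j k \<le> upper_end N mu L (Suc j) k"
    proof -
      have "L j k \<le> (\<Sum>m=l..j. mu m) - (\<Sum>m=l+1..k. L (Suc j) m) - (\<Sum>m=k+1..N. L j m)"
        if l: "l \<in> {1..k}" for l
      proof -
        have "(\<Sum>m=l+1..k. L (Suc j) m) = (\<Sum>m=l..k-1. L (Suc j) (m + 1))"
          by (rule sum.reindex_bij_witness[of _ Suc "\<lambda>m. m - 1"]) (use l in auto)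
        also have "\<dots> \<le> (\<Sum>m=l..k-1. L j m)"
          by (intro sum_mono interlacing(2)) (use l kj j in auto)
        finally have "(\<Sum>m=l+1..k. L (Suc j) m) + (\<Sum>m=k..N. L j m) \<le> (\<Sum>m=l..k-1. L j m) + (\<Sum>m=k..N. L j m)"
          by simp
        also have "\<dots> = (\<Sum>m=l..N. L j m)"
          using sum.ub_add_nat[of l "k - 1" "L j" "N - (k - 1)"] l kj j by simp
        also have "\<dots> \<le> (\<Sum>m=l..j. mu m)" by (rule tail_sum_le) (use l kj j in auto)
        finally show ?thesis using head by simp
      qed
      moreover have "L j k \<le> L (Suc j) k" by (rule interlacing(1)) (use j k in auto)
      ultimately show ?thesis unfolding upper_end_def using kj by simp
    qed
    ultimately show ?thesis using False unfolding j(1) by simp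
  qed
qed simp

theorem vectors_satisfy_step_B:
  assumes "N \<ge> 1" shows "step_B N mu L f"
  unfolding step_B_def
proof (intro conjI ballI)
  fix n t assume "n \<in> {1..N - 1}" "t \<in> L n ` {1..N}"
  then have n: "n < N" by auto
  show "((\<lambda>x. (x - t) * (spec_poly N L (n + 1) x / spec_poly N L n x)) \<longlongrightarrow>
      - vec_norm_sq (orth_proj
          (mat_kernel (complex_of_real t \<cdot>\<^sub>m 1\<^sub>m N - frame_operator N f n)) (f (n + 1)))) (at t)"
    using rank_one_update_residue[OF frame_operator_carrier self_adjoint_frame_operator spectrum
        spectrum_Suc(3)[OF n] spectrum_Suc(1)[OF n]]
    unfolding spec_poly_def by simp
qed (use f norm assms in auto)

end

text \<open>
  With \<open>A = U D U\<^sup>*\<close>, the factor is \<open>F = D\<^bsup>1/2\<^esup> U\<^sup>*\<close>.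
\<close>
lemma psd_factorization:
  assumes A: "A \<in> carrier_mat N N" "self_adjoint A" "has_spectrum N A a"
    and nonneg: "\<And>m. m \<in> {1..N} \<Longrightarrow> 0 \<le> a m"
  shows "\<exists>F \<in> carrier_mat N N. A = mat_adjoint F * F \<and> has_spectrum N (F * mat_adjoint F) a"
proof -
  obtain U where U: "diagonalizes N U a A" using spectral_theorem[OF A] by auto
  note Uc = unitaryD[OF diagonalizesD(1)[OF U]]
  define S where "S = mat_diag N (\<lambda>i. complex_of_real (sqrt (a (Suc i))))"
  define F where "F = S * mat_adjoint U"
  have S: "S \<in> carrier_mat N N" unfolding S_def by simp
  have Sadj: "mat_adjoint S = S" unfolding S_def by simp
  have SS: "S * S = mat_diag N (\<lambda>i. complex_of_real (a (Suc i)))"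
    unfolding S_def mat_diag_diag using nonneg
    by (intro eq_matI) (auto simp: mat_diag_def simp flip: of_real_mult)
  have F: "F \<in> carrier_mat N N" unfolding F_def by (rule mult_carrier_mat[OF S Uc(2)])
  have Fadj: "mat_adjoint F = U * S"
    unfolding F_def using mat_adjoint_mult[OF S Uc(2)] Sadj by simp
  have "mat_adjoint F * F = U * (S * S) * mat_adjoint U"
    unfolding Fadj unfolding F_def
    using assoc_mult_mat[OF mult_carrier_mat[OF Uc(1) S] S Uc(2)] assoc_mult_mat[OF Uc(1) S S] by simp
  then have 1: "A = mat_adjoint F * F" using diagonalizesD(2)[OF U] SS by simp
  have "has_spectrum N (F * mat_adjoint F) a"
    using A(3) char_poly_mult_commute[OF F mat_adjoint_carrier[OF F]] 1
    unfolding has_spectrum_def by simp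
  then show ?thesis using 1 F by blast
qed

theorem frame_construction_complete:
  assumes N: "N \<ge> 1" and lam: "antimono_on {1..N} lam" "\<And>m. m \<in> {1..N} \<Longrightarrow> 0 \<le> lam m"
    and G: "G \<in> carrier_mat N N" "self_adjoint G" "has_spectrum N G lam" "has_diagonal N G mu"
  shows "\<exists>F. F \<in> carrier_mat N N \<and> frame_construction N lam mu F \<and> G = mat_adjoint F * F"
proof -
  obtain F where F: "F \<in> carrier_mat N N" and GF: "G = mat_adjoint F * F"
    and sF: "has_spectrum N (F * mat_adjoint F) lam"
    using psd_factorization[OF G(1-3) lam(2)] by auto
  define f where "f k = col F (k - 1)" for k
  have Ff: "synthesis N f N = F" unfolding f_def by (rule synthesis_of_columns[OF F])
  have f: "f n \<in> carrier_vec N" if "n \<in> {1..N}" for n using F that unfolding f_def by auto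
  have mu: "vec_norm_sq (f n) = mu n" if "n \<in> {1..N}" for n
    using gram_matrix_diagonal[of n N f N, OF that f[OF that]] G(4) that unfolding Ff GF has_diagonal_def
    by (simp only: of_real_eq_iff)
  (* Step A prescribes L N as lam itself, hence the extra clause in the choice of L. *)
  have "\<exists>a. antimono_on {1..N} a \<and> has_spectrum N (frame_operator N f n) a \<and> (n = N \<longrightarrow> a = lam)" for n
  proof (cases "n = N")
    case True
    then show ?thesis using lam(1) sF unfolding frame_operator_def True Ff by auto
  next
    case False
    then show ?thesis
      using self_adjoint_sorted_spectrum[OF frame_operator_carrier self_adjoint_frame_operator] by blast
  qed
  then obtain L where L: "\<And>n. antimono_on {1..N} (L n)"
    "\<And>n. has_spectrum N (frame_operator N f n) (L n)" "L N = lam" by metis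
  interpret frame_spectra N mu f L by unfold_locales (use f mu L in auto)
  show ?thesis
    using F GF Ff spectra_satisfy_step_A vectors_satisfy_step_B[OF N] unfolding frame_construction_def L(3) by metis
qed

lemma least_eigenvalue_spectrum:
  assumes N: "N \<ge> 1" and lam: "antimono_on {1..N} lam"
    and G: "G \<in> carrier_mat N N" "has_spectrum N G lam"
  shows "least_eigenvalue G = lam N"
proof -
  have "eigenvalue G (complex_of_real x) \<longleftrightarrow> x \<in> lam ` {1..N}" for x
  proof -
    have "eigenvalue G (complex_of_real x) \<longleftrightarrow> (\<exists>m\<in>{1..N}. complex_of_real x = complex_of_real (lam m))"
      using G(2) unfolding eigenvalue_root_char_poly[OF G(1)] has_spectrum_iff_char_poly[OF G(1)]
      by (simp add: poly_prod prod_zero_iff)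
    then show ?thesis by auto
  qed
  then have "{x. eigenvalue G (complex_of_real x)} = lam ` {1..N}" by auto
  then show ?thesis unfolding least_eigenvalue_def
    using N monotone_onD[OF lam, of _ N] by (auto intro!: Min_eqI)
qed

section \<open>Self-adjoint matrices with prescribed spectrum and diagonal\<close>

theorem theorem2p1:
  fixes N :: nat and lam mu :: "nat \<Rightarrow> real"
  assumes "N \<ge> 1"
    and "antimono_on {1..N} lam"
    and "antimono_on {1..N} mu"
    and "majorizes N lam mu"
  shows "(\<forall>G \<in> carrier_mat N N.
            self_adjoint G \<and> has_spectrum N G lam \<and> has_diagonal N G mu \<longrightarrow>
              least_eigenvalue G = lam N \<and>
              (\<forall>\<alpha>::real. \<alpha> \<le> least_eigenvalue G \<longrightarrow>
                (\<exists>F. frame_construction N (\<lambda>n. lam n - \<alpha>) (\<lambda>n. mu n - \<alpha>) F \<and>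
                     G = mat_adjoint F * F + complex_of_real \<alpha> \<cdot>\<^sub>m 1\<^sub>m N)))
       \<and> (\<forall>(\<alpha>::real) F G.
            \<alpha> \<le> lam N \<and>
            frame_construction N (\<lambda>n. lam n - \<alpha>) (\<lambda>n. mu n - \<alpha>) F \<and>
            G = mat_adjoint F * F + complex_of_real \<alpha> \<cdot>\<^sub>m 1\<^sub>m N \<longrightarrow>
              has_spectrum N G lam \<and> has_diagonal N G mu)"
proof (intro conjI ballI allI impI)
  fix G assume G: "G \<in> carrier_mat N N" "self_adjoint G \<and> has_spectrum N G lam \<and> has_diagonal N G mu"
  then show least: "least_eigenvalue G = lam N"
    using least_eigenvalue_spectrum[OF assms(1,2)] by blast
  fix \<alpha> :: real assume "\<alpha> \<le> least_eigenvalue G"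
  then have al: "\<alpha> \<le> lam m" if "m \<in> {1..N}" for m
    using least monotone_onD[OF assms(2), of m N] that by auto
  let ?H = "G + complex_of_real (- \<alpha>) \<cdot>\<^sub>m 1\<^sub>m N"
  have H: "?H \<in> carrier_mat N N" by simp
  have "self_adjoint ?H" unfolding self_adjoint_def
  proof (rule eq_matI)
    fix i j assume "i < dim_row ?H" "j < dim_col ?H"
    then have ij: "i < N" "j < N" by auto
    then show "mat_adjoint ?H $$ (i, j) = ?H $$ (i, j)"
      using self_adjoint_nth[of G N i j] G by simp
  qed auto
  moreover have "has_spectrum N ?H (\<lambda>n. lam n - \<alpha>)"
    using has_spectrum_add_scalar[OF G(1), of lam "- \<alpha>"] G(2) by simp
  moreover have "has_diagonal N ?H (\<lambda>n. mu n - \<alpha>)"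
    using G unfolding has_diagonal_def by auto
  moreover have "antimono_on {1..N} (\<lambda>n. lam n - \<alpha>)"
    using assms(2) by (auto simp: monotone_on_def)
  ultimately obtain F where F: "F \<in> carrier_mat N N"
      "frame_construction N (\<lambda>n. lam n - \<alpha>) (\<lambda>n. mu n - \<alpha>) F" "?H = mat_adjoint F * F"
    using frame_construction_complete[OF assms(1) _ _ H, of "\<lambda>n. lam n - \<alpha>" "\<lambda>n. mu n - \<alpha>"] al by auto
  have "G = ?H + complex_of_real \<alpha> \<cdot>\<^sub>m 1\<^sub>m N"
    using G(1) by (intro eq_matI) auto
  then show "\<exists>F. frame_construction N (\<lambda>n. lam n - \<alpha>) (\<lambda>n. mu n - \<alpha>) F \<and>
      G = mat_adjoint F * F + complex_of_real \<alpha> \<cdot>\<^sub>m 1\<^sub>m N"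
    using F by auto
next
  fix \<alpha> :: real and F G
  assume *: "\<alpha> \<le> lam N \<and> frame_construction N (\<lambda>n. lam n - \<alpha>) (\<lambda>n. mu n - \<alpha>) F \<and>
    G = mat_adjoint F * F + complex_of_real \<alpha> \<cdot>\<^sub>m 1\<^sub>m N"
  then have fc: "frame_construction N (\<lambda>n. lam n - \<alpha>) (\<lambda>n. mu n - \<alpha>) F"
    and G: "G = mat_adjoint F * F + complex_of_real \<alpha> \<cdot>\<^sub>m 1\<^sub>m N" by auto
  have tr: "(\<Sum>m=1..N. lam m - \<alpha>) = (\<Sum>m=1..N. mu m - \<alpha>)"
    using assms(4) unfolding majorizes_def by (simp add: sum_subtractf)
  note sound = frame_construction_sound[OF assms(1) fc tr]
  have c: "mat_adjoint F * F \<in> carrier_mat N N" using sound(1) by auto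
  have "self_adjoint (mat_adjoint F * F)"
    using mat_adjoint_mult[OF mat_adjoint_carrier[OF sound(1)] sound(1)] by (simp add: self_adjoint_def)
  from has_spectrum_add_scalar[OF c this sound(2), of \<alpha>] show "has_spectrum N G lam"
    unfolding G by simp
  show "has_diagonal N G mu"
    using sound(3) c unfolding G has_diagonal_def by auto
qed

end
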